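(* Let $\{F_t\}_{t\ge0}$ and $\{\bar F_t\}_{t\ge0}$ be two-dimensional (open-set irreducible) Lévy-type processes with symbols $q(x,\xi)$ and $\bar q(x,\xi)$, both radial in the co-variable $\xi$, and Lévy triplets $(0,c(x)I,\nu(x,dy))$ and $(0,\bar c(x)I,\bar\nu(x,dy))$, respectively. Suppose that there exists a rotation of the plane $R_\varphi$, $\varphi\in[0,2\pi)$, such that $$\sup_{x\in\mathbb{R}^2}\int_{\mathbb{R}^2}|y|^2\,|\nu(x,dy)-\bar\nu(R_\varphi x,dy)|<\infty. \qquad (\mathrm{P})$$ Then $$\int_{B_r(0)}\frac{d\xi}{\sup_{x\in\mathbb{R}^2}|q(x,\xi)|}=\infty\ \text{ for some } r>0$$ if, and only if, $$\int_{B_r(0)}\frac{d\xi}{\sup_{x\in\mathbb{R}^2}|\bar q(x,\xi)|}=\infty\ \text{ for some } r>0.$$ Further, put $$c:=\frac12\sup_{x\in\mathbb{R}^2}|c(x)-\bar c(R_\varphi x)|+\sup_{x\in\mathbb{R}^2}\int_{\mathbb{R}^2}|y|^2\,|\nu(x,dy)-\bar\nu(R_\varphi x,dy)|.$$ If $$\liminf_{|\xi|\to0}\frac{\inf_{x\in\mathbb{R}^2}q(x,\xi)}{|\xi|^2}>c,$$ then, under (P), $$\int_{B_r(0)}\frac{d\xi}{\inf_{x\in\mathbb{R}^2}\mathrm{Re}\,q(x,\xi)}<\infty\ \text{ for some } r>0$$ if, and only if, $$\int_{B_r(0)}\frac{d\xi}{\inf_{x\in\mathbb{R}^2}\mathrm{Re}\,\bar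 q(x,\xi)}<\infty\ \text{ for some } r>0.$$
   Context: A Feller process on $\mathbb{R}^d$ is a Markov process $(\{F_t\}_{t\ge0},\{\mathbb{P}^x\}_{x\in\mathbb{R}^d})$ whose semigroup $P_tf(x)=\mathbb{E}^x[f(F_t)]$ is a strongly continuous semigroup on $C_\infty(\mathbb{R}^d)$, the continuous functions vanishing at infinity with the sup norm; its generator on $C_\infty(\mathbb{R}^d)$ is $(\mathcal{A},\mathcal{D}_{\mathcal{A}})$. If $C_c^\infty(\mathbb{R}^d)\subseteq\mathcal{D}_{\mathcal{A}}$, then on $C_c^\infty(\mathbb{R}^d)$ one has $\mathcal{A}f(x)=-\int_{\mathbb{R}^d}q(x,\xi)e^{i\langle\xi,x\rangle}\hat f(\xi)\,d\xi$, with $\hat f(\xi)=(2\pi)^{-d}\int e^{-i\langle\xi,x\rangle}f(x)\,dx$; $q:\mathbb{R}^d\times\mathbb{R}^d\to\mathbb{C}$ is called the symbol. It is measurable and locally bounded, and continuous and negative definite in the co-variable $\xi$. A Lévy-type process is a Feller process with (a) $C_c^\infty(\mathbb{R}^d)\subseteq\mathcal{D}_{\mathcal{A}}$, (b) $\sup_x|q(x,\xi)|\le K(1+|\xi|^2)$ for some finite $K>0$ and all $\xi$, (c) $q(x,0)=0$ for all $x$. Its symbol has the Lévy–Khintchine form $$q(x,\xi)=-i\langle\xi,b(x)\rangle+\tfrac12\langle\xi,C(x)\xi\rangle+\int_{\mathbb{R}^d}\left(1-e^{i\langle\xi,y\rangle}+i\langle\xi,y\rangle1_{B_1(0)}(y)\right)\nu(x,dy),$$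 with $b(x)\in\mathbb{R}^d$, $C(x)$ symmetric non-negative definite, and $\nu(x,dy)$ a Borel kernel (the Lévy measure) with $\nu(x,\{0\})=0$, $\int\min\{1,|y|^2\}\nu(x,dy)<\infty$; $(b(x),C(x),\nu(x,dy))$ is the Lévy triplet. The process is $\varphi$-irreducible if there is a $\sigma$-finite measure $\varphi$ on $\mathbb{R}^d$ such that $\varphi(B)>0$ implies $\int_0^\infty\mathbb{P}^x(F_t\in B)\,dt>0$ for all $x$; it is open-set irreducible if it has such an irreducibility measure with full support. $B_r(x)$ is the open ball. $R_\varphi=\begin{pmatrix}\cos\varphi&-\sin\varphi\\ \sin\varphi&\cos\varphi\end{pmatrix}$. The symbol is radial in the co-variable if $q(x,R_\varphi\xi)=q(x,\xi)$ for all $x,\xi\in\mathbb{R}^2$, $\varphi\in[0,2\pi)$; then $q$ is real and nonnegative, $b(x)=0$, $C(x)=c(x)I$ for a Borel function $c:\mathbb{R}^2\to[0,\infty)$ ($I$ the $2\times2$ identity matrix), and $\nu(x,\cdot)$ is rotationally invariant. $|\mu(dy)|$ denotes the total variation measure of a signed measure $\mu(dy)$ (a difference of two Lévy measures is understood as a $\sigma$-finite signed measure on $\mathbb{R}^2\setminus\{0\}$). Convention: $1/0=\infty$. *)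

theory Defs
  imports "HOL-Probability.Probability"
begin

section \<open>Markov and Feller processes\<close>

text \<open>
  A process with state space \<open>real^'n\<close> is given by the laws \<open>P x\<close> (all living on one measurable
  space) and the coordinate maps \<open>F t\<close>, where only \<open>t \<ge> 0\<close> is relevant.
\<close>

definition natural_filtration ::
    "'w measure \<Rightarrow> (real \<Rightarrow> 'w \<Rightarrow> real^'n) \<Rightarrow> real \<Rightarrow> 'w measure" where
  "natural_filtration M F s =
     sigma (space M) (\<Union>u\<in>{0..s}. {F u -` B \<inter> space M | B. B \<in> sets borel})"

definition markov_process ::
    "(real^'n \<Rightarrow> 'w measure) \<Rightarrow> (real \<Rightarrow> 'w \<Rightarrow> real^'n) \<Rightarrow> bool" where
  "markov_process P F \<longleftrightarrow>
     (\<forall>x. prob_space (P x)) \<and>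
     (\<forall>x y. sets (P x) = sets (P y)) \<and>
     (\<forall>x. \<forall>t\<ge>0. F t \<in> borel_measurable (P x)) \<and>
     (\<forall>x. AE w in P x. F 0 w = x) \<and>
     (\<forall>t\<ge>0. \<forall>B\<in>sets borel.
        (\<lambda>x. measure (P x) {w \<in> space (P x). F t w \<in> B}) \<in> borel_measurable borel) \<and>
     (\<forall>x. \<forall>s\<ge>0. \<forall>t\<ge>0. \<forall>B\<in>sets borel.
        AE w in P x.
          real_cond_exp (P x) (natural_filtration (P x) F s) (\<lambda>w. indicator B (F (s + t) w)) w =
          measure (P (F s w)) {w' \<in> space (P (F s w)). F t w' \<in> B})"

definition transition_semigroup ::
    "(real^'n \<Rightarrow> 'w measure) \<Rightarrow> (real \<Rightarrow> 'w \<Rightarrow> real^'n) \<Rightarrow>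
     real \<Rightarrow> (real^'n \<Rightarrow> real) \<Rightarrow> (real^'n \<Rightarrow> real)" where
  "transition_semigroup P F t f = (\<lambda>x. \<integral>w. f (F t w) \<partial>(P x))"

definition C_infty :: "(real^'n \<Rightarrow> real) set" where
  "C_infty = {f. continuous_on UNIV f \<and> (f \<longlongrightarrow> 0) at_infinity}"

text \<open>Convergence in the sup norm is expressed by \<^const>\<open>uniform_limit\<close> on \<^const>\<open>UNIV\<close>.\<close>

definition strongly_continuous_semigroup ::
    "(real \<Rightarrow> (real^'n \<Rightarrow> real) \<Rightarrow> (real^'n \<Rightarrow> real)) \<Rightarrow> bool" where
  "strongly_continuous_semigroup T \<longleftrightarrow>
     (\<forall>t\<ge>0. \<forall>f\<in>C_infty. T t f \<in> C_infty) \<and>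
     (\<forall>f\<in>C_infty. T 0 f = f) \<and>
     (\<forall>s\<ge>0. \<forall>t\<ge>0. \<forall>f\<in>C_infty. T (s + t) f = T s (T t f)) \<and>
     (\<forall>f\<in>C_infty. uniform_limit UNIV (\<lambda>t. T t f) f (at_right 0))"

definition feller_process ::
    "(real^'n \<Rightarrow> 'w measure) \<Rightarrow> (real \<Rightarrow> 'w \<Rightarrow> real^'n) \<Rightarrow> bool" where
  "feller_process P F \<longleftrightarrow>
     markov_process P F \<and> strongly_continuous_semigroup (transition_semigroup P F)"

definition is_generator_value ::
    "(real \<Rightarrow> (real^'n \<Rightarrow> real) \<Rightarrow> (real^'n \<Rightarrow> real)) \<Rightarrow>
     (real^'n \<Rightarrow> real) \<Rightarrow> (real^'n \<Rightarrow> real) \<Rightarrow> bool" where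
  "is_generator_value T f g \<longleftrightarrow>
     g \<in> C_infty \<and> uniform_limit UNIV (\<lambda>t x. (T t f x - f x) / t) g (at_right 0)"

definition generator_domain ::
    "(real \<Rightarrow> (real^'n \<Rightarrow> real) \<Rightarrow> (real^'n \<Rightarrow> real)) \<Rightarrow> (real^'n \<Rightarrow> real) set" where
  "generator_domain T = {f \<in> C_infty. \<exists>g. is_generator_value T f g}"

definition generator ::
    "(real \<Rightarrow> (real^'n \<Rightarrow> real) \<Rightarrow> (real^'n \<Rightarrow> real)) \<Rightarrow>
     (real^'n \<Rightarrow> real) \<Rightarrow> (real^'n \<Rightarrow> real)" where
  "generator T f = (THE g. is_generator_value T f g)"

section \<open>Symbols and Levy-type processes\<close>

fun k_times_cont_diff :: "nat \<Rightarrow> (real^'n \<Rightarrow> real) \<Rightarrow> bool" where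
  "k_times_cont_diff 0 f \<longleftrightarrow> continuous_on UNIV f"
| "k_times_cont_diff (Suc k) f \<longleftrightarrow>
     (\<forall>x. f differentiable (at x)) \<and>
     (\<forall>v\<in>Basis. k_times_cont_diff k (\<lambda>x. frechet_derivative f (at x) v))"

definition Cc_infty :: "(real^'n \<Rightarrow> real) set" where
  "Cc_infty = {f. (\<forall>k. k_times_cont_diff k f) \<and> compact (closure {x. f x \<noteq> 0})}"

definition fourier_transform :: "(real^'n \<Rightarrow> real) \<Rightarrow> real^'n \<Rightarrow> complex" where
  "fourier_transform f \<xi> =
     (\<integral>x. cis (- (\<xi> \<bullet> x)) * complex_of_real (f x) \<partial>lborel) /
     complex_of_real ((2 * pi) ^ CARD('n))"

text \<open>Negative definiteness in the sense of Schoenberg.\<close>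

definition negative_definite :: "(real^'n \<Rightarrow> complex) \<Rightarrow> bool" where
  "negative_definite \<psi> \<longleftrightarrow>
     (\<forall>(n::nat) (z :: nat \<Rightarrow> real^'n) (a :: nat \<Rightarrow> complex).
        (\<Sum>j<n. \<Sum>k<n. (\<psi> (z j) + cnj (\<psi> (z k)) - \<psi> (z j - z k)) * a j * cnj (a k)) \<in> \<real>\<^sub>\<ge>\<^sub>0)"

definition is_symbol ::
    "(real^'n \<Rightarrow> 'w measure) \<Rightarrow> (real \<Rightarrow> 'w \<Rightarrow> real^'n) \<Rightarrow>
     (real^'n \<Rightarrow> real^'n \<Rightarrow> complex) \<Rightarrow> bool" where
  "is_symbol P F q \<longleftrightarrow>
     (\<lambda>(x, \<xi>). q x \<xi>) \<in> borel_measurable borel \<and>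
     (\<forall>K. compact K \<longrightarrow> bounded ((\<lambda>(x, \<xi>). q x \<xi>) ` K)) \<and>
     (\<forall>x. continuous_on UNIV (q x) \<and> negative_definite (q x)) \<and>
     (\<forall>f\<in>Cc_infty. \<forall>x.
        complex_of_real (generator (transition_semigroup P F) f x) =
        - (\<integral>\<xi>. q x \<xi> * cis (\<xi> \<bullet> x) * fourier_transform f \<xi> \<partial>lborel))"

definition levy_type_process ::
    "(real^'n \<Rightarrow> 'w measure) \<Rightarrow> (real \<Rightarrow> 'w \<Rightarrow> real^'n) \<Rightarrow>
     (real^'n \<Rightarrow> real^'n \<Rightarrow> complex) \<Rightarrow> bool" where
  "levy_type_process P F q \<longleftrightarrow>
     feller_process P F \<and>
     Cc_infty \<subseteq> generator_domain (transition_semigroup P F) \<and>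
     is_symbol P F q \<and>
     (\<exists>K>0. \<forall>x \<xi>. cmod (q x \<xi>) \<le> K * (1 + (norm \<xi>)\<^sup>2)) \<and>
     (\<forall>x. q x 0 = 0)"

definition levy_measure :: "(real^'n) measure \<Rightarrow> bool" where
  "levy_measure \<nu> \<longleftrightarrow>
     sets \<nu> = sets borel \<and> emeasure \<nu> {0} = 0 \<and>
     (\<integral>\<^sup>+y. ennreal (min 1 ((norm y)\<^sup>2)) \<partial>\<nu>) < \<infinity>"

definition levy_triplet ::
    "(real^'n \<Rightarrow> real^'n \<Rightarrow> complex) \<Rightarrow>
     (real^'n \<Rightarrow> real^'n) \<Rightarrow> (real^'n \<Rightarrow> real^'n^'n) \<Rightarrow> (real^'n \<Rightarrow> (real^'n) measure) \<Rightarrow> bool" where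
  "levy_triplet q b C \<nu> \<longleftrightarrow>
     (\<forall>x. transpose (C x) = C x \<and> (\<forall>\<xi>. 0 \<le> \<xi> \<bullet> (C x *v \<xi>))) \<and>
     (\<forall>x. levy_measure (\<nu> x)) \<and>
     (\<forall>B\<in>sets borel. (\<lambda>x. emeasure (\<nu> x) B) \<in> borel_measurable borel) \<and>
     (\<forall>x \<xi>. q x \<xi> =
        - \<i> * complex_of_real (\<xi> \<bullet> b x) + complex_of_real (\<xi> \<bullet> (C x *v \<xi>)) / 2 +
        (\<integral>y. 1 - cis (\<xi> \<bullet> y) + \<i> * complex_of_real ((\<xi> \<bullet> y) * indicator (ball 0 1) y) \<partial>(\<nu> x)))"

section \<open>Irreducibility\<close>

definition irreducibility_measure ::
    "(real^'n \<Rightarrow> 'w measure) \<Rightarrow> (real \<Rightarrow> 'w \<Rightarrow> real^'n) \<Rightarrow> (real^'n) measure \<Rightarrow> bool" where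
  "irreducibility_measure P F \<phi> \<longleftrightarrow>
     sigma_finite_measure \<phi> \<and> sets \<phi> = sets borel \<and>
     (\<forall>B\<in>sets borel. emeasure \<phi> B > 0 \<longrightarrow>
        (\<forall>x. (\<integral>\<^sup>+t\<in>{0..}. emeasure (P x) {w \<in> space (P x). F t w \<in> B} \<partial>lborel) > 0))"

definition open_set_irreducible ::
    "(real^'n \<Rightarrow> 'w measure) \<Rightarrow> (real \<Rightarrow> 'w \<Rightarrow> real^'n) \<Rightarrow> bool" where
  "open_set_irreducible P F \<longleftrightarrow>
     (\<exists>\<phi>. irreducibility_measure P F \<phi> \<and> (\<forall>U. open U \<and> U \<noteq> {} \<longrightarrow> emeasure \<phi> U > 0))"

section \<open>Rotations of the plane\<close>

definition plane_rotation :: "real \<Rightarrow> real^2^2" where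
  "plane_rotation \<phi> = vector [vector [cos \<phi>, - sin \<phi>], vector [sin \<phi>, cos \<phi>]]"

definition radial_in_covariable :: "(real^2 \<Rightarrow> real^2 \<Rightarrow> complex) \<Rightarrow> bool" where
  "radial_in_covariable q \<longleftrightarrow>
     (\<forall>x \<xi>. \<forall>\<phi>\<in>{0..<2 * pi}. q x (plane_rotation \<phi> *v \<xi>) = q x \<xi>)"

section \<open>Total variation of a difference of two Levy measures\<close>

text \<open>
  A difference \<open>\<mu> - \<nu>\<close> of two Levy measures has the real value \<open>\<mu> A - \<nu> A\<close> on every Borel set \<open>A\<close>
  whose closure omits \<open>0\<close>; on other sets it may be of the form \<open>\<infinity> - \<infinity>\<close>. Its total variation is
  therefore the supremum over finite disjoint families of sets of the former kind. Since these
  sets exhaust the complement of \<open>{0}\<close>, this is the total variation of the sigma-finite signed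
  measure \<open>\<mu> - \<nu>\<close> there, and \<open>{0}\<close> gets mass \<open>0\<close>.
\<close>

definition variation_families :: "(real^'n) set \<Rightarrow> (real^'n) set set set" where
  "variation_families B =
     {\<P>. finite \<P> \<and> disjoint \<P> \<and> (\<forall>A\<in>\<P>. A \<in> sets borel \<and> A \<subseteq> B \<and> 0 \<notin> closure A)}"

definition variation :: "(real^'n) measure \<Rightarrow> (real^'n) measure \<Rightarrow> (real^'n) set \<Rightarrow> ennreal" where
  "variation \<mu> \<nu> B = (SUP \<P>\<in>variation_families B. \<Sum>A\<in>\<P>. ennreal \<bar>measure \<mu> A - measure \<nu> A\<bar>)"

definition total_variation_diff ::
    "(real^'n) measure \<Rightarrow> (real^'n) measure \<Rightarrow> (real^'n) measure" where
  "total_variation_diff \<mu> \<nu> = measure_of UNIV (sets borel) (variation \<mu> \<nu>)"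

lemma levy_measure_finite:
  assumes \<nu>: "levy_measure \<nu>" and A: "A \<in> sets borel" "0 \<notin> closure A"
  shows "emeasure \<nu> A < \<infinity>"
proof -
  from A(2) obtain e where e: "e > 0" "\<And>y. y \<in> A \<Longrightarrow> e \<le> norm y"
    by (fastforce simp: closure_approachable not_less)
  define d where "d = min 1 (e\<^sup>2)"
  have d: "d > 0" using e(1) by (simp add: d_def)
  have le: "d \<le> min 1 ((norm y)\<^sup>2)" if "y \<in> A" for y
    using power_mono[OF e(2)[OF that], of 2] e(1) by (auto simp: d_def intro: min.coboundedI2)
  have [measurable_cong]: "sets \<nu> = sets borel" using \<nu> by (simp add: levy_measure_def)
  have "ennreal d * emeasure \<nu> A = (\<integral>\<^sup>+y. ennreal d * indicator A y \<partial>\<nu>)"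
    using A(1) by (simp add: nn_integral_cmult_indicator)
  also have "\<dots> \<le> (\<integral>\<^sup>+y. ennreal (min 1 ((norm y)\<^sup>2)) \<partial>\<nu>)"
    using le by (intro nn_integral_mono) (auto simp: indicator_def intro!: ennreal_leI)
  also have "\<dots> < \<infinity>" using \<nu> by (simp add: levy_measure_def)
  finally show ?thesis using d by (auto simp: ennreal_mult_less_top)
qed

lemma variation_mono: "B \<subseteq> B' \<Longrightarrow> variation \<mu> \<nu> B \<le> variation \<mu> \<nu> B'"
  unfolding variation_def by (rule SUP_subset_mono) (auto simp: variation_families_def)

lemma variation_upper:
  "\<P> \<in> variation_families B \<Longrightarrow>
   (\<Sum>A\<in>\<P>. ennreal \<bar>measure \<mu> A - measure \<nu> A\<bar>) \<le> variation \<mu> \<nu> B"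
  unfolding variation_def by (rule SUP_upper)

lemma variation_superadditive:
  fixes A B :: "(real^'n) set"
  assumes "A \<inter> B = {}"
  shows "variation \<mu> \<nu> A + variation \<mu> \<nu> B \<le> variation \<mu> \<nu> (A \<union> B)"
proof -
  let ?d = "\<lambda>A. ennreal \<bar>measure \<mu> A - measure \<nu> A\<bar>"
  have ne: "variation_families C \<noteq> {}" for C :: "(real^'n) set"
  proof -
    have "{} \<in> variation_families C" by (simp add: variation_families_def)
    then show ?thesis by blast
  qed
  have "sum ?d \<P> + sum ?d \<Q> \<le> variation \<mu> \<nu> (A \<union> B)"
    if P: "\<P> \<in> variation_families A" and Q: "\<Q> \<in> variation_families B" for \<P> \<Q>
  proof -
    have disj: "X \<inter> Y = {}" if "X \<in> \<P>" "Y \<in> \<Q>" for X Y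
    proof -
      have "X \<subseteq> A" "Y \<subseteq> B" using that P Q by (auto simp: variation_families_def)
      then show ?thesis using assms by blast
    qed
    then have empty: "X = {}" if "X \<in> \<P> \<inter> \<Q>" for X using that by blast
    have union: "\<Union>\<P> \<inter> \<Union>\<Q> = {}" using disj by blast
    have "sum ?d \<P> + sum ?d \<Q> = sum ?d (\<P> \<union> \<Q>)"
    proof (rule sum.union_inter_neutral[symmetric])
      show "finite \<P>" "finite \<Q>" using P Q by (auto simp: variation_families_def)
      show "\<forall>X\<in>\<P> \<inter> \<Q>. ?d X = 0"
      proof
        fix X assume "X \<in> \<P> \<inter> \<Q>"
        then have "X = {}" by (rule empty)
        then show "?d X = 0" by simp
      qed
    qed
    also have "\<dots> \<le> variation \<mu> \<nu> (A \<union> B)"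
    proof (rule variation_upper)
      have "disjoint (\<P> \<union> \<Q>)"
        using P Q union by (intro disjoint_union) (auto simp: variation_families_def)
      then show "\<P> \<union> \<Q> \<in> variation_families (A \<union> B)"
        using P Q by (auto simp: variation_families_def)
    qed
    finally show ?thesis .
  qed
  then have "sum ?d \<P> + variation \<mu> \<nu> B \<le> variation \<mu> \<nu> (A \<union> B)"
    if "\<P> \<in> variation_families A" for \<P>
    unfolding variation_def[of _ _ B] ennreal_SUP_add_right[OF ne]
    using that by (intro SUP_least) blast
  then show ?thesis
    unfolding variation_def[of _ _ A] ennreal_SUP_add_left[OF ne, symmetric]
    by (intro SUP_least) blast
qed

lemma countably_additive_variation:
  fixes \<mu> \<nu> :: "(real^'n) measure"
  assumes \<mu>: "levy_measure \<mu>" and \<nu>: "levy_measure \<nu>"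
  shows "countably_additive (sets borel) (variation \<mu> \<nu>)"
proof (rule countably_additiveI)
  fix B :: "nat \<Rightarrow> (real^'n) set"
  assume B: "range B \<subseteq> sets borel" "disjoint_family B"
  let ?d = "\<lambda>A. measure \<mu> A - measure \<nu> A"
  have sets [simp]: "sets \<mu> = sets borel" "sets \<nu> = sets borel"
    using \<mu> \<nu> by (auto simp: levy_measure_def)
  show "(\<Sum>i. variation \<mu> \<nu> (B i)) = variation \<mu> \<nu> (\<Union>i. B i)"
  proof (rule antisym)
    have "(\<Sum>i<n. variation \<mu> \<nu> (B i)) \<le> variation \<mu> \<nu> (\<Union>i<n. B i)" for n
    proof (induction n)
      case (Suc n)
      have disj: "(\<Union>i<n. B i) \<inter> B n = {}"
      proof -
        have "B i \<inter> B n = {}" if "i < n" for i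
          using that disjoint_family_onD[OF B(2), of i n] by simp
        then show ?thesis by blast
      qed
      have "(\<Sum>i<Suc n. variation \<mu> \<nu> (B i)) \<le> variation \<mu> \<nu> (\<Union>i<n. B i) + variation \<mu> \<nu> (B n)"
        using Suc by (simp add: add_right_mono)
      also have "\<dots> \<le> variation \<mu> \<nu> ((\<Union>i<n. B i) \<union> B n)"
        by (rule variation_superadditive[OF disj])
      also have "(\<Union>i<n. B i) \<union> B n = (\<Union>i<Suc n. B i)" by (simp add: lessThan_Suc Un_commute)
      finally show ?case .
    qed simp
    moreover have "variation \<mu> \<nu> (\<Union>i<n. B i) \<le> variation \<mu> \<nu> (\<Union>i. B i)" for n
      by (rule variation_mono) auto
    ultimately show "(\<Sum>i. variation \<mu> \<nu> (B i)) \<le> variation \<mu> \<nu> (\<Union>i. B i)"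
      by (intro suminf_le_const) (auto intro: order_trans)
  next
    show "variation \<mu> \<nu> (\<Union>i. B i) \<le> (\<Sum>i. variation \<mu> \<nu> (B i))"
      unfolding variation_def[of _ _ "\<Union>i. B i"]
    proof (rule SUP_least)
      fix \<P> assume P: "\<P> \<in> variation_families (\<Union>i. B i)"
      have piece: "ennreal \<bar>?d A\<bar> \<le> (\<Sum>i. ennreal \<bar>?d (A \<inter> B i)\<bar>)" if "A \<in> \<P>" for A
      proof -
        have A: "A \<in> sets borel" "A = (\<Union>i. A \<inter> B i)" "0 \<notin> closure A"
          using that P by (auto simp: variation_families_def)
        have sums: "(\<lambda>i. measure M (A \<inter> B i)) sums measure M A" if M: "levy_measure M" for M
        proof -
          have "emeasure M (\<Union>i. A \<inter> B i) \<noteq> \<infinity>"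
            using levy_measure_finite[OF M A(1,3)] A(2) by simp
          then have "(\<lambda>i. measure M (A \<inter> B i)) sums measure M (\<Union>i. A \<inter> B i)"
            using A(1) B M
            by (intro measure_UNION) (auto simp: levy_measure_def disjoint_family_on_def)
          then show ?thesis using A(2) by simp
        qed
        have "summable (\<lambda>i. measure \<mu> (A \<inter> B i) + measure \<nu> (A \<inter> B i))"
          by (intro summable_add sums_summable[OF sums] \<mu> \<nu>)
        then have summ: "summable (\<lambda>i. \<bar>?d (A \<inter> B i)\<bar>)"
          by (rule summable_rabs_comparison_test[rotated])
            (auto intro!: exI[of _ 0] simp: abs_le_iff)
        have "?d A = (\<Sum>i. ?d (A \<inter> B i))"
          using sums_diff[OF sums[OF \<mu>] sums[OF \<nu>]] by (simp add: sums_iff)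
        then have "\<bar>?d A\<bar> \<le> (\<Sum>i. \<bar>?d (A \<inter> B i)\<bar>)" using summable_rabs[OF summ] by simp
        then have "ennreal \<bar>?d A\<bar> \<le> ennreal (\<Sum>i. \<bar>?d (A \<inter> B i)\<bar>)" by (rule ennreal_leI)
        also have "\<dots> = (\<Sum>i. ennreal \<bar>?d (A \<inter> B i)\<bar>)"
          using summ by (intro suminf_ennreal2[symmetric]) auto
        finally show ?thesis .
      qed
      have part: "(\<Sum>A\<in>\<P>. ennreal \<bar>?d (A \<inter> B i)\<bar>) \<le> variation \<mu> \<nu> (B i)" for i
      proof -
        have fin: "finite \<P>" using P by (simp add: variation_families_def)
        have "(\<Sum>A\<in>\<P>. ennreal \<bar>?d (A \<inter> B i)\<bar>) =
              sum (\<lambda>A. ennreal \<bar>?d A\<bar>) ((\<lambda>A. A \<inter> B i) ` \<P>)"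
        proof (subst sum.reindex_nontrivial[OF fin])
          fix X Y assume XY: "X \<in> \<P>" "Y \<in> \<P>" "X \<noteq> Y" "X \<inter> B i = Y \<inter> B i"
          then have "X \<inter> Y = {}" using P by (auto simp: variation_families_def disjoint_def)
          then have "X \<inter> B i = {}" using XY(4) by blast
          then show "ennreal \<bar>?d (X \<inter> B i)\<bar> = 0" by simp
        qed simp
        also have "\<dots> \<le> variation \<mu> \<nu> (B i)"
        proof (rule variation_upper)
          have "disjoint ((\<lambda>A. A \<inter> B i) ` \<P>)"
          proof (rule disjointI)
            fix C D
            assume "C \<in> (\<lambda>A. A \<inter> B i) ` \<P>" "D \<in> (\<lambda>A. A \<inter> B i) ` \<P>" "C \<noteq> D"
            then obtain X Y where XY: "X \<in> \<P>" "Y \<in> \<P>" "X \<noteq> Y" "C = X \<inter> B i" "D = Y \<inter> B i"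
              by blast
            then have "X \<inter> Y = {}" using P by (auto simp: variation_families_def disjoint_def)
            then show "C \<inter> D = {}" using XY by blast
          qed
          moreover have "0 \<notin> closure (A \<inter> B i)" if "A \<in> \<P>" for A
            using that P closure_mono[of "A \<inter> B i" A] by (auto simp: variation_families_def)
          ultimately show "(\<lambda>A. A \<inter> B i) ` \<P> \<in> variation_families (B i)"
            using P B(1) by (auto simp: variation_families_def)
        qed
        finally show ?thesis .
      qed
      have "(\<Sum>A\<in>\<P>. ennreal \<bar>?d A\<bar>) \<le> (\<Sum>A\<in>\<P>. \<Sum>i. ennreal \<bar>?d (A \<inter> B i)\<bar>)"
        by (intro sum_mono piece)
      also have "\<dots> = (\<Sum>i. \<Sum>A\<in>\<P>. ennreal \<bar>?d (A \<inter> B i)\<bar>)"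
        by (intro suminf_sum[symmetric]) auto
      also have "\<dots> \<le> (\<Sum>i. variation \<mu> \<nu> (B i))"
        by (intro suminf_le part) auto
      finally show "(\<Sum>A\<in>\<P>. ennreal \<bar>?d A\<bar>) \<le> (\<Sum>i. variation \<mu> \<nu> (B i))" .
    qed
  qed
qed

lemma emeasure_total_variation_diff:
  fixes \<mu> \<nu> :: "(real^'n) measure"
  assumes "levy_measure \<mu>" and "levy_measure \<nu>" and "B \<in> sets borel"
  shows "emeasure (total_variation_diff \<mu> \<nu>) B = variation \<mu> \<nu> B"
proof -
  have "variation \<mu> \<nu> {} \<le> 0"
    unfolding variation_def
  proof (rule SUP_least)
    fix \<P> :: "(real^'n) set set" assume "\<P> \<in> variation_families {}"
    then show "(\<Sum>A\<in>\<P>. ennreal \<bar>measure \<mu> A - measure \<nu> A\<bar>) \<le> 0"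
      by (intro sum_nonpos) (auto simp: variation_families_def)
  qed
  then have "positive (sets borel) (variation \<mu> \<nu>)" by (simp add: positive_def)
  then show ?thesis
    unfolding total_variation_diff_def
    using assms countably_additive_variation sets.sigma_algebra_axioms[of borel]
    by (intro emeasure_measure_of_sigma) auto
qed

end

theory Submission
  imports Defs
begin

text \<open>
  A symbol that is radial in the co-variable is even, hence real, and equals
  \<open>c(x)|\<xi>|\<^sup>2/2 + \<integral>(1 - cos \<langle>\<xi>,y\<rangle>) \<nu>(x,dy)\<close>
  (\<open>radial_symbol_eq_levy_exponent\<close>). Since \<open>0 \<le> 1 - cos \<langle>\<xi>,y\<rangle> \<le> |\<xi>|\<^sup>2|y|\<^sup>2\<close>, two such symbols satisfy
  \<open>|q(x,\<xi>) - q'(Rx,\<xi>)| \<le> A|\<xi>|\<^sup>2\<close>, where \<open>A\<close> combines the distance of the diffusion coefficients with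
  the second moment of \<open>|\<nu>(x,\<cdot>) - \<nu>'(Rx,\<cdot>)|\<close> (\<open>levy_exponent_diff_le\<close>). Because the rotation
  \<open>R\<close> is onto, suprema and infima over the state space are perturbed by the same amount, so both
  equivalences reduce to the claim that a perturbation of order \<open>|\<xi>|\<^sup>2\<close> is harmless.

  For the suprema, the reason is a dichotomy (\<open>symbol_sup_degenerate_or_quadratic\<close>). Either \<open>q\<close>
  vanishes identically or some \<open>q(x,\<cdot>)\<close> is bounded below by a multiple of \<open>|\<xi>|\<^sup>2\<close> on every ball.
  In the second case the perturbation is absorbed in a constant factor. In the first case the
  perturbed supremum is at most \<open>A|\<xi>|\<^sup>2\<close>, whose reciprocal has infinite integral over every disc,
  because the dimension is two. The lower bound itself comes from \<open>q(\<xi>+\<eta>) \<le> 2q(\<xi>) + 2q(\<eta>)\<close>: in the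
  plane every vector of length at most \<open>2\<rho>\<close> is the sum of two vectors of length \<open>\<rho>\<close>, so a radial
  exponent that is positive somewhere is bounded below at all large \<open>\<xi>\<close>, and doubling transports the
  bound to small \<open>\<xi>\<close> at the rate \<open>|\<xi>|\<^sup>2\<close>.

  For the infima, the assumption on the lower limit makes \<open>q(x,\<xi>)\<close> at least \<open>A'|\<xi>|\<^sup>2\<close> near the
  origin with some \<open>A' > A\<close>, uniformly in \<open>x\<close>. Then \<open>q(x,\<cdot>)\<close> and \<open>q'(Rx,\<cdot>)\<close> are comparable there
  up to constant factors, again uniformly in \<open>x\<close>.
\<close>

section \<open>Exponents of symmetric Levy triplets\<close>

text \<open>The Levy--Khintchine exponent of the triplet \<open>(0, aI, \<mu>)\<close> when \<open>\<mu>\<close> is symmetric.\<close>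

definition levy_exponent :: "real \<Rightarrow> (real^'n) measure \<Rightarrow> real^'n \<Rightarrow> real" where
  "levy_exponent a \<mu> \<xi> = a / 2 * (norm \<xi>)\<^sup>2 + (\<integral>y. 1 - cos (\<xi> \<bullet> y) \<partial>\<mu>)"

lemma one_minus_cos_le: "1 - cos t \<le> t\<^sup>2 / 2" for t :: real
proof -
  have "\<bar>sin (t / 2)\<bar> \<le> \<bar>t / 2\<bar>" by (rule abs_sin_x_le_abs_x)
  then have "(sin (t / 2))\<^sup>2 \<le> (t / 2)\<^sup>2" by (simp only: abs_le_square_iff)
  then show ?thesis using cos_double_sin[of "t / 2"] by (simp add: power2_eq_square field_simps)
qed

lemma inner_power2_le: "(\<xi> \<bullet> y)\<^sup>2 \<le> (norm \<xi>)\<^sup>2 * (norm y)\<^sup>2" for \<xi> y :: "'a::real_inner"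
  using Cauchy_Schwarz_ineq[of \<xi> y] by (simp only: power2_norm_eq_inner)

lemma one_minus_cos_inner_le:
  "1 - cos (\<xi> \<bullet> y) \<le> (norm \<xi>)\<^sup>2 * (norm y)\<^sup>2" for \<xi> y :: "'a::real_inner"
proof -
  have "1 - cos (\<xi> \<bullet> y) \<le> (\<xi> \<bullet> y)\<^sup>2"
    using one_minus_cos_le[of "\<xi> \<bullet> y"] zero_le_power2[of "\<xi> \<bullet> y"] by linarith
  also have "\<dots> \<le> (norm \<xi>)\<^sup>2 * (norm y)\<^sup>2" by (rule inner_power2_le)
  finally show ?thesis .
qed

text \<open>
  By \<open>1 - cos t = 2 sin\<^sup>2(t/2)\<close> this is the subadditivity of \<open>|sin|\<close>, squared. It is
  the source of the quadratic behaviour of the exponents.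
\<close>
lemma one_minus_cos_add_le:
  "1 - cos (s + t) \<le> 2 * (1 - cos s) + 2 * (1 - cos t)" for s t :: real
proof -
  have half: "1 - cos u = 2 * (sin (u / 2))\<^sup>2" for u :: real
    using cos_double_sin[of "u / 2"] by simp
  have "\<bar>sin ((s + t) / 2)\<bar> \<le> \<bar>sin (s / 2)\<bar> * \<bar>cos (t / 2)\<bar> + \<bar>cos (s / 2)\<bar> * \<bar>sin (t / 2)\<bar>"
    using abs_triangle_ineq[of "sin (s / 2) * cos (t / 2)" "cos (s / 2) * sin (t / 2)"]
    by (simp add: add_divide_distrib sin_add abs_mult)
  also have "\<dots> \<le> \<bar>sin (s / 2)\<bar> * 1 + 1 * \<bar>sin (t / 2)\<bar>"
    by (intro add_mono mult_mono) auto
  finally have "(sin ((s + t) / 2))\<^sup>2 \<le> (\<bar>sin (s / 2)\<bar> + \<bar>sin (t / 2)\<bar>)\<^sup>2"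
    by (simp add: abs_le_square_iff[symmetric])
  also have "\<dots> \<le> 2 * (sin (s / 2))\<^sup>2 + 2 * (sin (t / 2))\<^sup>2"
    using sum_squares_bound[of "\<bar>sin (s / 2)\<bar>" "\<bar>sin (t / 2)\<bar>"] by (simp add: power2_sum)
  finally show ?thesis by (simp add: half)
qed

lemma levy_measure_integrable:
  fixes f :: "real^'n \<Rightarrow> 'b::{banach, second_countable_topology}"
  assumes \<mu>: "levy_measure \<mu>" and [measurable]: "f \<in> borel_measurable borel"
    and le: "\<And>y. norm (f y) \<le> A * min 1 ((norm y)\<^sup>2)"
  shows "integrable \<mu> f"
proof -
  have [measurable_cong]: "sets \<mu> = sets borel" using \<mu> by (simp add: levy_measure_def)
  have "integrable \<mu> (\<lambda>y. min 1 ((norm y)\<^sup>2))"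
    using \<mu> by (intro integrableI_nonneg) (auto simp: levy_measure_def)
  then have "integrable \<mu> (\<lambda>y. A * min 1 ((norm y)\<^sup>2))" by simp
  then show ?thesis
    by (rule Bochner_Integration.integrable_bound) (auto intro!: AE_I2 order_trans[OF le])
qed

lemma integrable_one_minus_cos:
  assumes "levy_measure \<mu>"
  shows "integrable \<mu> (\<lambda>y. 1 - cos (\<xi> \<bullet> y))"
proof (rule levy_measure_integrable[OF assms, where A = "max 2 ((norm \<xi>)\<^sup>2)"])
  fix y
  have "max 2 ((norm \<xi>)\<^sup>2) * min 1 ((norm y)\<^sup>2) \<ge> 1 - cos (\<xi> \<bullet> y)"
  proof (cases "1 \<le> (norm y)\<^sup>2")
    case True
    moreover have "1 - cos (\<xi> \<bullet> y) \<le> 2" using cos_ge_minus_one[of "\<xi> \<bullet> y"] by linarith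
    ultimately show ?thesis by (simp add: le_max_iff_disj)
  next
    case False
    then show ?thesis using one_minus_cos_inner_le[of \<xi> y]
      mult_right_mono[of "(norm \<xi>)\<^sup>2" "max 2 ((norm \<xi>)\<^sup>2)" "(norm y)\<^sup>2"] by simp
  qed
  then show "norm (1 - cos (\<xi> \<bullet> y)) \<le> max 2 ((norm \<xi>)\<^sup>2) * min 1 ((norm y)\<^sup>2)" by simp
qed simp

lemma integrable_levy_khintchine:
  fixes \<xi> :: "real^'n"
  assumes "levy_measure \<mu>"
  shows "integrable \<mu>
    (\<lambda>y. 1 - cis (\<xi> \<bullet> y) + \<i> * complex_of_real ((\<xi> \<bullet> y) * indicator (ball 0 1) y))"
proof (rule levy_measure_integrable[OF assms, where A = "max 2 ((norm \<xi>)\<^sup>2)"])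
  fix y :: "real^'n"
  let ?f = "1 - cis (\<xi> \<bullet> y) + \<i> * complex_of_real ((\<xi> \<bullet> y) * indicator (ball 0 1) y)"
  show "norm ?f \<le> max 2 ((norm \<xi>)\<^sup>2) * min 1 ((norm y)\<^sup>2)"
  proof (cases "norm y < 1")
    case False
    then have "1 \<le> (norm y)\<^sup>2" by (simp add: one_le_power)
    moreover have "norm ?f \<le> 2"
      using False norm_triangle_ineq4[of 1 "cis (\<xi> \<bullet> y)"] by simp
    ultimately show ?thesis by simp
  next
    case True
    then have y: "(norm y)\<^sup>2 < 1" by (simp add: power_less_one_iff abs_square_less_1)
    have "norm ?f = norm (cis (\<xi> \<bullet> y) - (1 + \<i> * complex_of_real (\<xi> \<bullet> y)))"
      using True by (subst norm_minus_commute) (simp add: algebra_simps)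
    also have "\<dots> \<le> (\<xi> \<bullet> y)\<^sup>2 / 2"
      using iexp_approx1[of "\<xi> \<bullet> y" 1] by (simp add: cis_conv_exp power2_eq_square)
    also have "\<dots> \<le> (\<xi> \<bullet> y)\<^sup>2" by simp
    also have "\<dots> \<le> (norm \<xi>)\<^sup>2 * (norm y)\<^sup>2" by (rule inner_power2_le)
    also have "\<dots> \<le> max 2 ((norm \<xi>)\<^sup>2) * (norm y)\<^sup>2" by (intro mult_right_mono) auto
    finally show ?thesis using y by simp
  qed
next
  have [measurable]: "(\<lambda>y. cis (\<xi> \<bullet> y)) \<in> borel_measurable borel"
    by (intro borel_measurable_continuous_onI continuous_intros)
  have [measurable]: "ball (0::real^'n) 1 \<in> sets borel" by simp
  show "(\<lambda>y. 1 - cis (\<xi> \<bullet> y) + \<i> * complex_of_real ((\<xi> \<bullet> y) * indicator (ball 0 1) y))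
    \<in> borel_measurable borel"
    by measurable
qed

lemma levy_exponent_nonneg: "0 \<le> a \<Longrightarrow> 0 \<le> levy_exponent a \<mu> \<xi>"
  unfolding levy_exponent_def by (intro add_nonneg_nonneg Bochner_Integration.integral_nonneg) auto

lemma levy_exponent_add_le:
  assumes \<mu>: "levy_measure \<mu>" and a: "0 \<le> a"
  shows "levy_exponent a \<mu> (\<xi> + \<eta>) \<le> 2 * levy_exponent a \<mu> \<xi> + 2 * levy_exponent a \<mu> \<eta>"
proof -
  note int = integrable_one_minus_cos[OF \<mu>]
  have "(norm (\<xi> + \<eta>))\<^sup>2 \<le> (norm \<xi> + norm \<eta>)\<^sup>2" by (intro power_mono norm_triangle_ineq) simp
  also have "\<dots> \<le> 2 * (norm \<xi>)\<^sup>2 + 2 * (norm \<eta>)\<^sup>2"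
    using sum_squares_bound[of "norm \<xi>" "norm \<eta>"] by (simp add: power2_sum)
  finally have "a / 2 * (norm (\<xi> + \<eta>))\<^sup>2 \<le> a / 2 * (2 * (norm \<xi>)\<^sup>2 + 2 * (norm \<eta>)\<^sup>2)"
    using a by (intro mult_left_mono) auto
  moreover have "(\<integral>y. 1 - cos ((\<xi> + \<eta>) \<bullet> y) \<partial>\<mu>) \<le>
      (\<integral>y. 2 * (1 - cos (\<xi> \<bullet> y)) + 2 * (1 - cos (\<eta> \<bullet> y)) \<partial>\<mu>)"
    by (intro integral_mono int Bochner_Integration.integrable_add integrable_mult_right)
      (simp add: inner_add_left one_minus_cos_add_le[simplified])
  moreover have "\<dots> = 2 * (\<integral>y. 1 - cos (\<xi> \<bullet> y) \<partial>\<mu>) + 2 * (\<integral>y. 1 - cos (\<eta> \<bullet> y) \<partial>\<mu>)"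
    by (simp only: Bochner_Integration.integral_add integrable_mult_right integral_mult_right_zero int)
  ultimately show ?thesis by (simp add: levy_exponent_def algebra_simps)
qed

lemma levy_exponent_power_le:
  assumes "levy_measure \<mu>" "0 \<le> a"
  shows "levy_exponent a \<mu> (2 ^ n *\<^sub>R \<xi>) \<le> 4 ^ n * levy_exponent a \<mu> \<xi>"
proof (induction n)
  case (Suc n)
  have "2 ^ Suc n *\<^sub>R \<xi> = 2 ^ n *\<^sub>R \<xi> + 2 ^ n *\<^sub>R \<xi>" by (simp flip: scaleR_add_left)
  then show ?case using levy_exponent_add_le[OF assms, of "2 ^ n *\<^sub>R \<xi>" "2 ^ n *\<^sub>R \<xi>"] Suc by simp
qed simp

section \<open>Rotations and circles in the plane\<close>

lemma norm_power2_plane: "(norm \<xi>)\<^sup>2 = (\<xi> $ 1)\<^sup>2 + (\<xi> $ 2)\<^sup>2" for \<xi> :: "real^2"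
  unfolding power2_norm_eq_inner by (simp add: inner_vec_def sum_2 power2_eq_square)

lemma plane_rotation_apply:
  "plane_rotation \<phi> *v \<xi> =
     vector [cos \<phi> * \<xi> $ 1 - sin \<phi> * \<xi> $ 2, sin \<phi> * \<xi> $ 1 + cos \<phi> * \<xi> $ 2]"
  by (simp add: plane_rotation_def vec_eq_iff forall_2 matrix_vector_mult_def sum_2)

lemma plane_rotation_surj: "\<exists>x. plane_rotation \<phi> *v x = y"
proof
  have "(cos \<phi>)\<^sup>2 + (sin \<phi>)\<^sup>2 = 1" by simp
  then show "plane_rotation \<phi> *v (plane_rotation (- \<phi>) *v y) = y"
    unfolding plane_rotation_apply vec_eq_iff forall_2 
    by (simp, algebra)
qed

text \<open>
  In complex notation the rotation that takes \<open>\<xi>\<close> to \<open>\<eta>\<close> is multiplication by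
  \<open>\<eta>/\<xi>\<close>; the numbers \<open>u\<close> and \<open>v\<close> of the proof are its real and imaginary parts.
\<close>

lemma plane_rotation_transitive:
  fixes \<xi> \<eta> :: "real^2"
  assumes eq: "norm \<xi> = norm \<eta>"
  shows "\<exists>\<phi>\<in>{0..<2 * pi}. plane_rotation \<phi> *v \<xi> = \<eta>"
proof (cases "\<xi> = 0")
  case True
  then have "plane_rotation 0 *v \<xi> = \<eta>" using eq by (simp add: matrix_vector_mult_0_right)
  then show ?thesis by (intro bexI[of _ 0]) auto
next
  case False
  define n where "n = (norm \<xi>)\<^sup>2"
  have n: "n \<noteq> 0" using False by (simp add: n_def)
  have n\<xi>: "n = (\<xi> $ 1)\<^sup>2 + (\<xi> $ 2)\<^sup>2" and n\<eta>: "n = (\<eta> $ 1)\<^sup>2 + (\<eta> $ 2)\<^sup>2"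
    unfolding n_def by (simp_all only: norm_power2_plane[symmetric] eq)
  define u where "u = (\<xi> $ 1 * \<eta> $ 1 + \<xi> $ 2 * \<eta> $ 2) / n"
  define v where "v = (\<xi> $ 1 * \<eta> $ 2 - \<xi> $ 2 * \<eta> $ 1) / n"
  have nu: "n * u = \<xi> $ 1 * \<eta> $ 1 + \<xi> $ 2 * \<eta> $ 2"
    and nv: "n * v = \<xi> $ 1 * \<eta> $ 2 - \<xi> $ 2 * \<eta> $ 1"
    using n by (simp_all add: u_def v_def)
  have "n * n * (u\<^sup>2 + v\<^sup>2) = (n * u)\<^sup>2 + (n * v)\<^sup>2"
    by (simp add: power2_eq_square algebra_simps)
  also have "\<dots> = ((\<xi> $ 1)\<^sup>2 + (\<xi> $ 2)\<^sup>2) * ((\<eta> $ 1)\<^sup>2 + (\<eta> $ 2)\<^sup>2)"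
    unfolding nu nv by (simp add: power2_eq_square algebra_simps)
  also have "\<dots> = n * n * 1" by (simp flip: n\<xi> n\<eta>)
  finally have "u\<^sup>2 + v\<^sup>2 = 1" using n by simp
  then obtain t where t: "0 \<le> t" "t < 2 * pi" "u = cos t" "v = sin t"
    using sincos_total_2pi by metis
  have "n * (u * \<xi> $ 1 - v * \<xi> $ 2) = (n * u) * \<xi> $ 1 - (n * v) * \<xi> $ 2"
    by (simp add: algebra_simps)
  also have "\<dots> = ((\<xi> $ 1)\<^sup>2 + (\<xi> $ 2)\<^sup>2) * \<eta> $ 1"
    unfolding nu nv by (simp add: power2_eq_square algebra_simps)
  finally have 1: "n * (u * \<xi> $ 1 - v * \<xi> $ 2) = n * \<eta> $ 1" by (simp flip: n\<xi>)
  have "n * (v * \<xi> $ 1 + u * \<xi> $ 2) = (n * v) * \<xi> $ 1 + (n * u) * \<xi> $ 2"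
    by (simp add: algebra_simps)
  also have "\<dots> = ((\<xi> $ 1)\<^sup>2 + (\<xi> $ 2)\<^sup>2) * \<eta> $ 2"
    unfolding nu nv by (simp add: power2_eq_square algebra_simps)
  finally have 2: "n * (v * \<xi> $ 1 + u * \<xi> $ 2) = n * \<eta> $ 2" by (simp flip: n\<xi>)
  from 1 2have "plane_rotation t *v \<xi> = \<eta>"
    using n t by (simp add: plane_rotation_apply vec_eq_iff forall_2)
  then show ?thesis using t by (intro bexI[of _ t]) auto
qed

lemma radial_norm_cong:
  assumes "radial_in_covariable q" "norm \<xi> = norm \<eta>"
  shows "q x \<xi> = q x \<eta>"
  using plane_rotation_transitive[OF assms(2)] assms(1)
  unfolding radial_in_covariable_def by metis

text \<open>The two summands are the sides of an isosceles triangle with base \<open>\<zeta>\<close>.\<close>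

lemma plane_sum_of_circle:
  fixes \<zeta> :: "real^2"
  assumes "\<zeta> \<noteq> 0" "norm \<zeta> \<le> 2 * \<rho>"
  shows "\<exists>\<xi> \<eta>. \<zeta> = \<xi> + \<eta> \<and> norm \<xi> = \<rho> \<and> norm \<eta> = \<rho>"
proof -
  define t where "t = sqrt (\<rho>\<^sup>2 / (norm \<zeta>)\<^sup>2 - 1 / 4)"
  have \<rho>: "0 \<le> \<rho>" using assms(2) norm_ge_zero[of \<zeta>] by linarith
  have "(norm \<zeta>)\<^sup>2 \<le> (2 * \<rho>)\<^sup>2" using assms(2) by (intro power_mono) auto
  then have "0 \<le> \<rho>\<^sup>2 / (norm \<zeta>)\<^sup>2 - 1 / 4"
    using assms(1) by (simp add: field_simps)
  then have t: "(norm \<zeta>)\<^sup>2 * (1 / 4 + t\<^sup>2) = \<rho>\<^sup>2"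
    using assms(1) by (simp add: t_def)
  \<comment> \<open>\<open>w\<close> is \<open>\<zeta>\<close> turned by a right angle and scaled to the height of the triangle\<close>
  define w :: "real^2" where "w = vector [- t * \<zeta> $ 2, t * \<zeta> $ 1]"
  have nrm: "norm ((1 / 2) *\<^sub>R \<zeta> + w) = \<rho>" "norm ((1 / 2) *\<^sub>R \<zeta> - w) = \<rho>"
    by (rule power2_eq_imp_eq[OF _ norm_ge_zero \<rho>],
        simp add: w_def norm_power2_plane flip: t, simp add: power2_eq_square algebra_simps)+
  have "\<zeta> = ((1 / 2) *\<^sub>R \<zeta> + w) + ((1 / 2) *\<^sub>R \<zeta> - w)" by (simp flip: scaleR_add_left)
  with nrm show ?thesis by blast
qed

section \<open>The quadratic lower bound for radial exponents\<close>

text \<open>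
  A point \<open>\<zeta>\<close> with positive exponent is a sum of two vectors of length \<open>|\<xi>|\<close> as soon as
  \<open>|\<zeta>| \<le> 2|\<xi>|\<close>, and radiality makes the exponents of both summands equal to that of \<open>\<xi>\<close>. This
  bounds the exponent from below away from the origin. A smaller \<open>\<xi>\<close> is doubled until it is that
  long; each doubling multiplies the exponent by at most \<open>4\<close>, and \<open>|\<xi>|\<^sup>2\<close> by exactly \<open>4\<close>.
\<close>

lemma radial_levy_exponent_lower_bound:
  fixes \<mu> :: "(real^2) measure"
  assumes \<mu>: "levy_measure \<mu>" and a: "0 \<le> a"
    and radial: "\<And>\<xi> \<eta>. norm \<xi> = norm \<eta> \<Longrightarrow> levy_exponent a \<mu> \<xi> = levy_exponent a \<mu> \<eta>"
    and pos: "levy_exponent a \<mu> \<zeta> \<noteq> 0"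
  shows "\<exists>C>0. \<forall>\<xi>\<in>ball 0 r. C * (norm \<xi>)\<^sup>2 \<le> levy_exponent a \<mu> \<xi>"
proof -
  let ?\<psi> = "levy_exponent a \<mu>"
  have \<zeta>: "\<zeta> \<noteq> 0" using pos by (auto simp: levy_exponent_def)
  have pos': "?\<psi> \<zeta> > 0" using pos levy_exponent_nonneg[OF a, of \<mu> \<zeta>] by simp
  have far: "?\<psi> \<zeta> \<le> 4 * ?\<psi> \<xi>" if le: "norm \<zeta> \<le> 2 * norm \<xi>" for \<xi>
  proof -
    obtain \<alpha> \<beta> where "\<zeta> = \<alpha> + \<beta>" "norm \<alpha> = norm \<xi>" "norm \<beta> = norm \<xi>"
      using plane_sum_of_circle[OF \<zeta> le] by blast
    then show ?thesis
      using levy_exponent_add_le[OF \<mu> a, of \<alpha> \<beta>] radial[of \<alpha> \<xi>] radial[of \<beta> \<xi>] by simp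
  qed
  define m where "m = max r (norm \<zeta>)"
  have m: "m > 0" using \<zeta> by (simp add: m_def less_max_iff_disj)
  have "?\<psi> \<zeta> / (4 * m\<^sup>2) * (norm \<xi>)\<^sup>2 \<le> ?\<psi> \<xi>" if \<xi>: "\<xi> \<in> ball 0 r" for \<xi>
  proof (cases "norm \<zeta> \<le> 2 * norm \<xi> \<or> \<xi> = 0")
    case True
    have "norm \<xi> \<le> m" using \<xi> by (simp add: m_def)
    then have "(norm \<xi>)\<^sup>2 \<le> m\<^sup>2" by (intro power_mono) auto
    then have "?\<psi> \<zeta> * (norm \<xi>)\<^sup>2 \<le> ?\<psi> \<zeta> * m\<^sup>2" using pos' by simp
    moreover have "?\<psi> \<zeta> * m\<^sup>2 \<le> (4 * ?\<psi> \<xi>) * m\<^sup>2" if "\<xi> \<noteq> 0"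
      using far[of \<xi>] True that by (intro mult_right_mono) auto
    ultimately have "?\<psi> \<zeta> * (norm \<xi>)\<^sup>2 \<le> 4 * ?\<psi> \<xi> * m\<^sup>2"
      using levy_exponent_nonneg[OF a, of \<mu> \<xi>] by (cases "\<xi> = 0") auto
    then show ?thesis using m by (simp add: field_simps)
  next
    case False
    \<comment> \<open>the number of doublings; minimality keeps \<open>2\<^sup>k|\<xi>|\<close> below \<open>|\<zeta>|\<close>\<close>
    define k where "k = (LEAST k. norm \<zeta> \<le> 2 * (2 ^ k * norm \<xi>))"
    have ex: "\<exists>k. norm \<zeta> \<le> 2 * (2 ^ k * norm \<xi>)"
    proof -
      obtain k where "norm \<zeta> / (2 * norm \<xi>) < 2 ^ k" using real_arch_pow[of 2] by auto
      then show ?thesis using False by (intro exI[of _ k]) (simp add: field_simps)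
    qed
    have k: "norm \<zeta> \<le> 2 * norm (2 ^ k *\<^sub>R \<xi>)"
      using LeastI_ex[OF ex] by (simp add: k_def)
    have "k \<noteq> 0"
      using k False by (cases k) auto
    then obtain j where j: "k = Suc j" by (cases k) auto
    have "\<not> norm \<zeta> \<le> 2 * (2 ^ j * norm \<xi>)"
      using not_less_Least[of j "\<lambda>k. norm \<zeta> \<le> 2 * (2 ^ k * norm \<xi>)"] j by (simp add: k_def)
    then have "2 ^ k * norm \<xi> \<le> m" by (simp add: j m_def)
    then have "(2 ^ k * norm \<xi>)\<^sup>2 \<le> m\<^sup>2" by (intro power_mono) auto
    moreover have four: "(2::real) ^ k * 2 ^ k = 4 ^ k" by (simp flip: power_mult_distrib)
    have "(2 ^ k * norm \<xi>)\<^sup>2 = 4 ^ k * (norm \<xi>)\<^sup>2"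
      by (simp add: power_mult_distrib power2_eq_square four)
    ultimately have le: "4 ^ k * (norm \<xi>)\<^sup>2 \<le> m\<^sup>2" by simp
    have "?\<psi> \<zeta> \<le> 4 * (4 ^ k * ?\<psi> \<xi>)"
      using far[OF k] levy_exponent_power_le[OF \<mu> a, of k \<xi>] by linarith
    then have "?\<psi> \<zeta> * (norm \<xi>)\<^sup>2 \<le> 4 * (4 ^ k * ?\<psi> \<xi>) * (norm \<xi>)\<^sup>2"
      by (intro mult_right_mono) auto
    also have "\<dots> = 4 * ?\<psi> \<xi> * (4 ^ k * (norm \<xi>)\<^sup>2)" by simp
    also have "\<dots> \<le> 4 * ?\<psi> \<xi> * m\<^sup>2"
      using le levy_exponent_nonneg[OF a, of \<mu> \<xi>] by (intro mult_left_mono) auto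
    finally show ?thesis using m by (simp add: field_simps)
  qed
  then show ?thesis using pos' m by (intro exI[of _ "?\<psi> \<zeta> / (4 * m\<^sup>2)"]) auto
qed

section \<open>Comparison through the total variation\<close>

lemma variation_commute: "variation \<mu> \<nu> = variation \<nu> \<mu>"
  by (simp add: variation_def abs_minus_commute fun_eq_iff)

lemma sets_total_variation_diff [simp, measurable_cong]:
  "sets (total_variation_diff \<mu> \<nu>) = sets borel"
  unfolding total_variation_diff_def by (metis sets.sets_measure_of_eq space_borel)

text \<open>
  For sets that stay away from the origin this is the one-set partition in the definition of the
  variation; the general case is exhausted by such sets, as Levy measures do not charge \<open>0\<close>.
  Stated with sums instead of differences it also makes sense for sets of infinite mass.
\<close>

lemma emeasure_le_add_total_variation:
  fixes \<mu> \<nu> :: "(real^'n) measure"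
  assumes \<mu>: "levy_measure \<mu>" and \<nu>: "levy_measure \<nu>" and A: "A \<in> sets borel"
  shows "emeasure \<mu> A \<le> emeasure \<nu> A + emeasure (total_variation_diff \<mu> \<nu>) A"
proof -
  have [measurable_cong, simp]: "sets \<mu> = sets borel" "sets \<nu> = sets borel"
    using \<mu> \<nu> by (auto simp: levy_measure_def)
  define B where "B n = A \<inter> {y. 1 / real (Suc n) \<le> norm y}" for n
  have [measurable]: "B n \<in> sets borel" for n
    unfolding B_def by (intro sets.Int A borel_closed closed_Collect_le continuous_intros)
  have away: "0 \<notin> closure (B n)" for n
  proof -
    have "closure (B n) \<subseteq> {y. 1 / real (Suc n) \<le> norm y}"
    proof (rule closure_minimal)
      show "closed {y::real^'n. 1 / real (Suc n) \<le> norm y}"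
        by (intro closed_Collect_le continuous_intros)
    qed (simp add: B_def)
    then show ?thesis by (auto simp: not_le)
  qed
  have finite_case: "emeasure \<mu> (B n) \<le> emeasure \<nu> A + emeasure (total_variation_diff \<mu> \<nu>) A" for n
  proof -
    have m: "emeasure \<mu> (B n) = ennreal (measure \<mu> (B n))"
      and n: "emeasure \<nu> (B n) = ennreal (measure \<nu> (B n))"
      using levy_measure_finite[OF \<mu> _ away, of n] levy_measure_finite[OF \<nu> _ away, of n]
      by (auto intro!: emeasure_eq_ennreal_measure)
    have "ennreal (measure \<mu> (B n)) \<le>
        ennreal (measure \<nu> (B n)) + ennreal \<bar>measure \<mu> (B n) - measure \<nu> (B n)\<bar>"
      by (simp flip: ennreal_plus)
    also have "ennreal \<bar>measure \<mu> (B n) - measure \<nu> (B n)\<bar> \<le> variation \<mu> \<nu> (B n)"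
      using variation_upper[of "{B n}" "B n" \<mu> \<nu>] away by (simp add: variation_families_def)
    also have "variation \<mu> \<nu> (B n) = emeasure (total_variation_diff \<mu> \<nu>) (B n)"
      by (simp add: emeasure_total_variation_diff[OF \<mu> \<nu>])
    finally have "emeasure \<mu> (B n) \<le> emeasure \<nu> (B n) + emeasure (total_variation_diff \<mu> \<nu>) (B n)"
      unfolding m n by (simp only: add_left_mono)
    also have "\<dots> \<le> emeasure \<nu> A + emeasure (total_variation_diff \<mu> \<nu>) A"
      using A by (intro add_mono emeasure_mono) (auto simp: B_def)
    finally show ?thesis .
  qed
  have "A - {0} = (\<Union>n. B n)"
  proof -
    have "\<exists>n. 1 / real (Suc n) \<le> norm y" if "y \<noteq> 0" for y :: "real^'n"
    proof -
      obtain n where "inverse (real (Suc n)) < norm y" using reals_Archimedean[of "norm y"] \<open>y \<noteq> 0\<close> by auto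
      then show ?thesis by (intro exI[of _ n]) (simp add: inverse_eq_divide)
    qed
    moreover have "0 \<notin> B n" for n using away closure_subset by blast
    ultimately show ?thesis by (auto simp: B_def)
  qed
  moreover have "incseq B"
  proof (rule incseq_SucI)
    fix n
    have "1 / real (Suc (Suc n)) \<le> 1 / real (Suc n)" by (intro divide_left_mono) auto
    then show "B n \<le> B (Suc n)" unfolding B_def by (auto simp del: of_nat_Suc)
  qed
  ultimately have "emeasure \<mu> (A - {0}) = (SUP n. emeasure \<mu> (B n))"
    by (subst SUP_emeasure_incseq) auto
  also have "\<dots> \<le> emeasure \<nu> A + emeasure (total_variation_diff \<mu> \<nu>) A"
    by (intro SUP_least finite_case)
  finally have "emeasure \<mu> (A - {0}) \<le> emeasure \<nu> A + emeasure (total_variation_diff \<mu> \<nu>) A" .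
  moreover have "emeasure \<mu> A = emeasure \<mu> (A - {0})"
    using \<mu> A by (intro emeasure_Diff_null_set[symmetric]) (auto simp: levy_measure_def null_sets_def)
  ultimately show ?thesis by simp
qed

lemma nn_integral_le_add_measure:
  assumes [measurable_cong]: "sets M = sets N" "sets L = sets N"
    and le: "\<And>A. A \<in> sets N \<Longrightarrow> emeasure M A \<le> emeasure N A + emeasure L A"
    and f: "f \<in> borel_measurable N"
  shows "(\<integral>\<^sup>+x. f x \<partial>M) \<le> (\<integral>\<^sup>+x. f x \<partial>N) + (\<integral>\<^sup>+x. f x \<partial>L)"
  using f
proof (induct rule: borel_measurable_induct)
  case (cong f g)
  have "space M = space N" "space L = space N"
    using assms(1,2) by (auto dest: sets_eq_imp_space_eq)
  then have "integral\<^sup>N K f = integral\<^sup>N K g" if "K \<in> {M, N, L}" for K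
    using cong(3) that by (intro nn_integral_cong) auto
  with cong(4) show ?case by simp
next
  case (set A)
  then show ?case using le[of A] assms(1,2) by simp
next
  case (mult u c)
  have "c * (\<integral>\<^sup>+x. u x \<partial>M) \<le> c * ((\<integral>\<^sup>+x. u x \<partial>N) + (\<integral>\<^sup>+x. u x \<partial>L))"
    by (intro mult_left_mono mult) simp
  with mult(2) show ?case by (simp add: nn_integral_cmult distrib_left)
next
  case (add u v)
  have "(\<integral>\<^sup>+x. u x \<partial>M) + (\<integral>\<^sup>+x. v x \<partial>M) \<le>
      ((\<integral>\<^sup>+x. u x \<partial>N) + (\<integral>\<^sup>+x. u x \<partial>L)) + ((\<integral>\<^sup>+x. v x \<partial>N) + (\<integral>\<^sup>+x. v x \<partial>L))"
    by (intro add_mono add)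
  with add(1,4) show ?case by (simp add: nn_integral_add ac_simps)
next
  case (seq U)
  note seq(1)[measurable]
  have "(\<integral>\<^sup>+x. (SUP i. U i) x \<partial>M) = (SUP i. \<integral>\<^sup>+x. U i x \<partial>M)"
    unfolding SUP_apply using seq by (intro nn_integral_monotone_convergence_SUP) auto
  also have "\<dots> \<le> (\<integral>\<^sup>+x. (SUP i. U i) x \<partial>N) + (\<integral>\<^sup>+x. (SUP i. U i) x \<partial>L)"
    unfolding SUP_apply
    by (intro SUP_least order_trans[OF seq(3)] add_mono nn_integral_mono SUP_upper) auto
  finally show ?case .
qed

lemma integral_one_minus_cos_le:
  fixes \<mu> \<nu> :: "(real^'n) measure"
  assumes \<mu>: "levy_measure \<mu>" and \<nu>: "levy_measure \<nu>" and "0 \<le> M"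
    and M: "(\<integral>\<^sup>+y. ennreal ((norm y)\<^sup>2) \<partial>(total_variation_diff \<mu> \<nu>)) \<le> ennreal M"
  shows "(\<integral>y. 1 - cos (\<xi> \<bullet> y) \<partial>\<mu>) \<le> (\<integral>y. 1 - cos (\<xi> \<bullet> y) \<partial>\<nu>) + M * (norm \<xi>)\<^sup>2"
proof -
  have [measurable_cong, simp]: "sets \<mu> = sets borel" "sets \<nu> = sets borel"
    using \<mu> \<nu> by (auto simp: levy_measure_def)
  let ?g = "\<lambda>y. ennreal (1 - cos (\<xi> \<bullet> y))"
  have eq: "(\<integral>\<^sup>+y. ?g y \<partial>\<kappa>) = ennreal (\<integral>y. 1 - cos (\<xi> \<bullet> y) \<partial>\<kappa>)" if "levy_measure \<kappa>" for \<kappa>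
    using integrable_one_minus_cos[OF that] by (intro nn_integral_eq_integral) auto
  have "(\<integral>\<^sup>+y. ?g y \<partial>\<mu>) \<le> (\<integral>\<^sup>+y. ?g y \<partial>\<nu>) + (\<integral>\<^sup>+y. ?g y \<partial>total_variation_diff \<mu> \<nu>)"
    by (rule nn_integral_le_add_measure) (auto intro: emeasure_le_add_total_variation[OF \<mu> \<nu>])
  also have "(\<integral>\<^sup>+y. ?g y \<partial>total_variation_diff \<mu> \<nu>) \<le>
      (\<integral>\<^sup>+y. ennreal ((norm \<xi>)\<^sup>2) * ennreal ((norm y)\<^sup>2) \<partial>total_variation_diff \<mu> \<nu>)"
    by (intro nn_integral_mono) (auto simp flip: ennreal_mult intro!: ennreal_leI one_minus_cos_inner_le)
  also have "\<dots> = ennreal ((norm \<xi>)\<^sup>2) * (\<integral>\<^sup>+y. ennreal ((norm y)\<^sup>2) \<partial>total_variation_diff \<mu> \<nu>)"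
    by (intro nn_integral_cmult) measurable
  also have "\<dots> \<le> ennreal ((norm \<xi>)\<^sup>2) * ennreal M" by (intro mult_left_mono M) simp
  finally have "ennreal (\<integral>y. 1 - cos (\<xi> \<bullet> y) \<partial>\<mu>) \<le>
      ennreal (\<integral>y. 1 - cos (\<xi> \<bullet> y) \<partial>\<nu>) + ennreal ((norm \<xi>)\<^sup>2 * M)"
    using \<open>0 \<le> M\<close> by (simp add: eq \<mu> \<nu> ennreal_mult add_left_mono)
  also have "\<dots> = ennreal ((\<integral>y. 1 - cos (\<xi> \<bullet> y) \<partial>\<nu>) + (norm \<xi>)\<^sup>2 * M)"
    using \<open>0 \<le> M\<close> by (intro ennreal_plus[symmetric] Bochner_Integration.integral_nonneg) auto
  finally show ?thesis
    using \<open>0 \<le> M\<close>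
    by (subst (asm) ennreal_le_iff)
      (auto simp: mult.commute intro!: add_nonneg_nonneg Bochner_Integration.integral_nonneg)
qed

text \<open>
  The variation is symmetric in the two measures, so the one-sided estimate for the jump parts
  applies in both directions.
\<close>

lemma levy_exponent_diff_le:
  fixes \<mu> \<nu> :: "(real^'n) measure"
  assumes \<mu>: "levy_measure \<mu>" and \<nu>: "levy_measure \<nu>" and "0 \<le> M"
    and M: "(\<integral>\<^sup>+y. ennreal ((norm y)\<^sup>2) \<partial>(total_variation_diff \<mu> \<nu>)) \<le> ennreal M"
    and D: "\<bar>a - b\<bar> \<le> D"
  shows "\<bar>levy_exponent a \<mu> \<xi> - levy_exponent b \<nu> \<xi>\<bar> \<le> (D / 2 + M) * (norm \<xi>)\<^sup>2"
proof -
  have M': "(\<integral>\<^sup>+y. ennreal ((norm y)\<^sup>2) \<partial>(total_variation_diff \<nu> \<mu>)) \<le> ennreal M"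
    using M by (simp add: total_variation_diff_def variation_commute[of \<nu> \<mu>])
  have "\<bar>a / 2 * (norm \<xi>)\<^sup>2 - b / 2 * (norm \<xi>)\<^sup>2\<bar> = \<bar>a - b\<bar> / 2 * (norm \<xi>)\<^sup>2"
    by (simp add: abs_mult flip: left_diff_distrib diff_divide_distrib)
  also have "\<dots> \<le> D / 2 * (norm \<xi>)\<^sup>2" using D by (intro mult_right_mono) auto
  finally show ?thesis
    using integral_one_minus_cos_le[OF \<mu> \<nu> \<open>0 \<le> M\<close> M, of \<xi>]
      integral_one_minus_cos_le[OF \<nu> \<mu> \<open>0 \<le> M\<close> M', of \<xi>]
    by (simp only: levy_exponent_def distrib_right abs_le_iff) linarith
qed

section \<open>Radial symbols\<close>

text \<open>
  Rotation by \<open>\<pi>\<close> gives \<open>q(x,-\<xi>) = q(x,\<xi>)\<close>. The imaginary part of the Levy--Khintchine integral is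
  odd in \<open>\<xi>\<close>, so it vanishes.
\<close>

lemma radial_symbol_eq_levy_exponent:
  assumes radial: "radial_in_covariable q"
    and triplet: "levy_triplet q (\<lambda>x. 0) (\<lambda>x. c x *\<^sub>R mat 1) \<nu>"
  shows "q x \<xi> = complex_of_real (levy_exponent (c x) (\<nu> x) \<xi>)"
proof -
  have \<nu>: "levy_measure (\<nu> x)" using triplet by (simp add: levy_triplet_def)
  let ?h = "\<lambda>\<xi> y. 1 - cis (\<xi> \<bullet> y) + \<i> * complex_of_real ((\<xi> \<bullet> y) * indicator (ball 0 1) y)"
  have q: "q x \<xi> = complex_of_real (c x / 2 * (norm \<xi>)\<^sup>2) + (\<integral>y. ?h \<xi> y \<partial>(\<nu> x))" for \<xi>
    using triplet
    by (simp add: levy_triplet_def scaleR_matrix_vector_assoc[symmetric] power2_norm_eq_inner)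
  note int = integrable_levy_khintchine[OF \<nu>]
  have Re: "Re (q x \<xi>) = levy_exponent (c x) (\<nu> x) \<xi>" for \<xi>
    by (simp add: q levy_exponent_def integral_Re[OF int, symmetric] del: of_real_mult)
  have Im: "Im (q x \<xi>) = (\<integral>y. - sin (\<xi> \<bullet> y) + (\<xi> \<bullet> y) * indicator (ball 0 1) y \<partial>(\<nu> x))" for \<xi>
    by (simp add: q integral_Im[OF int, symmetric] del: of_real_mult)
  have "Im (q x (- \<xi>)) = - Im (q x \<xi>)"
    unfolding Im by (subst Bochner_Integration.integral_minus[symmetric]) simp
  moreover have "q x (- \<xi>) = q x \<xi>" by (rule radial_norm_cong[OF radial]) simp
  ultimately have "Im (q x \<xi>) = 0" by simp
  then show ?thesis by (simp add: complex_eq_iff Re)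
qed

text \<open>
  A symbol that does not vanish identically has a state \<open>x\<close> where the radial lower bound applies,
  and the supremum over all states inherits it.
\<close>

lemma symbol_sup_degenerate_or_quadratic:
  fixes q :: "real^2 \<Rightarrow> real^2 \<Rightarrow> complex"
  assumes radial: "radial_in_covariable q" and c: "\<And>x. 0 \<le> c x"
    and triplet: "levy_triplet q (\<lambda>x. 0) (\<lambda>x. c x *\<^sub>R mat 1) \<nu>"
  shows "(\<forall>\<xi>. (SUP x. ennreal (cmod (q x \<xi>))) = 0) \<or>
    (\<exists>C>0. \<forall>\<xi>\<in>ball 0 r. ennreal (C * (norm \<xi>)\<^sup>2) \<le> (SUP x. ennreal (cmod (q x \<xi>))))"
proof (cases "\<exists>x \<zeta>. q x \<zeta> \<noteq> 0")
  case True
  then obtain x \<zeta> where x: "q x \<zeta> \<noteq> 0" by blast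
  have q: "q x \<xi> = complex_of_real (levy_exponent (c x) (\<nu> x) \<xi>)" for \<xi>
    by (rule radial_symbol_eq_levy_exponent[OF radial triplet])
  have "\<exists>C>0. \<forall>\<xi>\<in>ball 0 r. C * (norm \<xi>)\<^sup>2 \<le> levy_exponent (c x) (\<nu> x) \<xi>"
  proof (rule radial_levy_exponent_lower_bound)
    show "levy_measure (\<nu> x)" using triplet by (simp add: levy_triplet_def)
    show "0 \<le> c x" by (rule c)
    show "levy_exponent (c x) (\<nu> x) \<zeta> \<noteq> 0" using x by (simp add: q)
    show "levy_exponent (c x) (\<nu> x) \<xi> = levy_exponent (c x) (\<nu> x) \<eta>" if "norm \<xi> = norm \<eta>" for \<xi> \<eta>
      using radial_norm_cong[OF radial that, of x] by (simp add: q)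
  qed
  then obtain C where "C > 0" and C: "\<And>\<xi>. \<xi> \<in> ball 0 r \<Longrightarrow> C * (norm \<xi>)\<^sup>2 \<le> levy_exponent (c x) (\<nu> x) \<xi>"
    by blast
  have "ennreal (C * (norm \<xi>)\<^sup>2) \<le> (SUP x. ennreal (cmod (q x \<xi>)))" if "\<xi> \<in> ball 0 r" for \<xi>
  proof (rule SUP_upper2[OF UNIV_I])
    show "ennreal (C * (norm \<xi>)\<^sup>2) \<le> ennreal (cmod (q x \<xi>))"
      using C[OF that] by (intro ennreal_leI) (simp add: q)
  qed
  then show ?thesis using \<open>C > 0\<close> by blast
qed simp

text \<open>
  The uniform bound \<open>|q(x,\<xi>)| \<le> K(1 + |\<xi>|\<^sup>2)\<close> at a unit vector bounds \<open>c(x)\<close>, because the jump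
  part of the exponent is nonnegative.
\<close>

lemma levy_type_diffusion_bounded:
  fixes q :: "real^2 \<Rightarrow> real^2 \<Rightarrow> complex"
  assumes "levy_type_process P F q" and radial: "radial_in_covariable q"
    and triplet: "levy_triplet q (\<lambda>x. 0) (\<lambda>x. c x *\<^sub>R mat 1) \<nu>"
  shows "\<exists>B\<ge>0. \<forall>x. c x \<le> B"
proof -
  obtain K where K: "K > 0" "\<And>x \<xi>. cmod (q x \<xi>) \<le> K * (1 + (norm \<xi>)\<^sup>2)"
    using assms(1) unfolding levy_type_process_def by blast
  have "c x \<le> 4 * K" for x
  proof -
    have "0 \<le> (\<integral>y. 1 - cos (axis 1 1 \<bullet> y) \<partial>(\<nu> x))" by (intro Bochner_Integration.integral_nonneg) auto
    then have "c x / 2 \<le> levy_exponent (c x) (\<nu> x) (axis 1 1)"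
      by (simp add: levy_exponent_def norm_axis_1)
    also have "\<dots> \<le> cmod (q x (axis 1 1))"
      by (simp add: radial_symbol_eq_levy_exponent[OF radial triplet])
    also have "\<dots> \<le> 2 * K" using K(2)[of x "axis 1 1"] by (simp add: norm_axis_1)
    finally show ?thesis by simp
  qed
  then show ?thesis using K(1) by (intro exI[of _ "4 * K"]) auto
qed

section \<open>Integrals of reciprocals\<close>

text \<open>
  In dimension two the disc of radius \<open>s\<close> has measure \<open>\<pi> s\<^sup>2\<close>, while \<open>|\<xi>|\<^sup>-\<^sup>2 \<ge> s\<^sup>-\<^sup>2\<close>
  on it. Hence the integral over each disc is at least \<open>\<pi>\<close>, however small the disc. If the integral
  were finite, continuity from above would force it to tend to \<open>0\<close> as the discs shrink to a point.
\<close>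

lemma inverse_norm_power2_not_integrable:
  assumes r: "0 < r"
  shows "(\<integral>\<^sup>+\<xi>\<in>ball 0 r. 1 / ennreal ((norm (\<xi>::real^2))\<^sup>2) \<partial>lborel) = \<infinity>"
proof (rule ccontr)
  define \<mu> where "\<mu> = density lborel (\<lambda>\<xi>::real^2. 1 / ennreal ((norm \<xi>)\<^sup>2))"
  define B :: "nat \<Rightarrow> (real^2) set" where "B n = ball 0 (r / real (Suc n))" for n
  assume "(\<integral>\<^sup>+\<xi>\<in>ball 0 r. 1 / ennreal ((norm (\<xi>::real^2))\<^sup>2) \<partial>lborel) \<noteq> \<infinity>"
  then have fin: "emeasure \<mu> (B 0) \<noteq> \<infinity>" by (simp add: \<mu>_def emeasure_density B_def)
  have dec: "decseq B"
  proof (rule decseq_SucI)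
    show "B (Suc n) \<le> B n" for n
      unfolding B_def using r by (intro subset_ball divide_left_mono) auto
  qed
  have B: "B n \<in> sets \<mu>" for n by (simp add: \<mu>_def B_def)
  have "(\<lambda>n. emeasure \<mu> (B n)) \<longlonglongrightarrow> emeasure \<mu> (\<Inter>n. B n)"
  proof (rule Lim_emeasure_decseq[OF _ dec])
    show "emeasure \<mu> (B n) \<noteq> \<infinity>" for n
      using fin emeasure_mono[OF decseqD[OF dec, of 0 n] B] by (auto simp: top_unique)
  qed (use B in auto)
  moreover have "(\<Inter>n. B n) = {0}"
  proof -
    have "\<exists>n. y \<notin> B n" if "y \<noteq> 0" for y
    proof -
      obtain n where n: "r / norm y < real n" using reals_Archimedean2 by blast
      then have "r < real n * norm y" using that by (simp add: field_simps)
      also have "\<dots> \<le> real (Suc n) * norm y" by (intro mult_right_mono) auto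
      finally have "r / real (Suc n) \<le> norm y" by (simp add: field_simps)
      then show ?thesis by (intro exI[of _ n]) (simp add: B_def del: of_nat_Suc)
    qed
    moreover have "0 \<in> B n" for n using r by (simp add: B_def)
    ultimately show ?thesis by blast
  qed
  moreover have "emeasure \<mu> {0} = 0"
    by (simp add: \<mu>_def emeasure_density nn_integral_indicator_singleton')
  ultimately have lim: "(\<lambda>n. emeasure \<mu> (B n)) \<longlonglongrightarrow> 0" by simp
  have "ennreal pi \<le> emeasure \<mu> (B n)" for n
  proof -
    define s where "s = r / real (Suc n)"
    have s: "s > 0" using r by (simp add: s_def)
    have "ennreal pi = ennreal (1 / s\<^sup>2) * emeasure lborel (ball (0::real^2) s)"
      using s by (simp add: emeasure_ball unit_ball_vol_2 flip: ennreal_mult)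
    also have "\<dots> = (\<integral>\<^sup>+\<xi>\<in>ball (0::real^2) s. ennreal (1 / s\<^sup>2) \<partial>lborel)"
      by (simp add: nn_integral_cmult_indicator)
    also have "\<dots> \<le> (\<integral>\<^sup>+\<xi>\<in>ball (0::real^2) s. 1 / ennreal ((norm \<xi>)\<^sup>2) \<partial>lborel)"
    proof (rule nn_integral_mono)
      fix \<xi> :: "real^2"
      show "ennreal (1 / s\<^sup>2) * indicator (ball 0 s) \<xi> \<le> 1 / ennreal ((norm \<xi>)\<^sup>2) * indicator (ball 0 s) \<xi>"
      proof (cases "\<xi> \<noteq> 0 \<and> norm \<xi> < s")
        case True
        then have "ennreal (1 / s\<^sup>2) \<le> ennreal (1 / (norm \<xi>)\<^sup>2)"
          using s by (intro ennreal_leI divide_left_mono power_mono mult_pos_pos) auto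
        also have "\<dots> = 1 / ennreal ((norm \<xi>)\<^sup>2)"
          using True divide_ennreal[of 1 "(norm \<xi>)\<^sup>2"] by simp
        finally show ?thesis using True by simp
      qed (auto simp: ennreal_divide_zero indicator_def)
    qed
    also have "\<dots> = emeasure \<mu> (B n)" by (simp add: \<mu>_def emeasure_density B_def s_def)
    finally show ?thesis .
  qed
  then have "ennreal pi \<le> 0" by (intro LIMSEQ_le_const[OF lim]) auto
  then show False by simp
qed

lemma ennreal_inverse_antimono: "x \<le> y \<Longrightarrow> inverse y \<le> inverse x" for x y :: ennreal
  including ennreal.lifting by transfer (auto intro: ereal_inverse_antimono)

lemma nn_integral_inverse_le:
  fixes f g :: "'a::euclidean_space \<Rightarrow> ennreal"
  assumes [measurable]: "f \<in> borel_measurable borel" and k: "0 < k"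
    and le: "\<And>\<xi>. \<xi> \<in> ball 0 r \<Longrightarrow> f \<xi> \<le> ennreal k * g \<xi>"
  shows "(\<integral>\<^sup>+\<xi>\<in>ball 0 r. 1 / g \<xi> \<partial>lborel) \<le> ennreal k * (\<integral>\<^sup>+\<xi>\<in>ball 0 r. 1 / f \<xi> \<partial>lborel)"
proof -
  have "1 / g \<xi> \<le> ennreal k * (1 / f \<xi>)" if "\<xi> \<in> ball 0 r" for \<xi>
  proof -
    have "ennreal (1 / k) * f \<xi> \<le> ennreal (1 / k) * (ennreal k * g \<xi>)"
      by (intro mult_left_mono le that) simp
    also have "\<dots> = g \<xi>" using k by (simp add: mult.assoc[symmetric] flip: ennreal_mult)
    finally have "inverse (g \<xi>) \<le> inverse (ennreal (1 / k) * f \<xi>)"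
      by (rule ennreal_inverse_antimono)
    also have "\<dots> = ennreal k * inverse (f \<xi>)"
      using k by (subst ennreal_inverse_mult') (auto simp: inverse_ennreal)
    finally show ?thesis by (simp add: divide_ennreal_def)
  qed
  then have "(\<integral>\<^sup>+\<xi>\<in>ball 0 r. 1 / g \<xi> \<partial>lborel) \<le>
      (\<integral>\<^sup>+\<xi>. ennreal k * (1 / f \<xi> * indicator (ball 0 r) \<xi>) \<partial>lborel)"
    by (intro nn_integral_mono) (auto simp: indicator_def)
  also have "\<dots> = ennreal k * (\<integral>\<^sup>+\<xi>\<in>ball 0 r. 1 / f \<xi> \<partial>lborel)"
    by (intro nn_integral_cmult borel_measurable_times_ennreal borel_measurable_indicator) simp_all
  finally show ?thesis .
qed

text \<open>
  If \<open>f\<close> dominates a multiple of \<open>|\<xi>|\<^sup>2\<close>, then \<open>g\<close> is at most a multiple of \<open>f\<close>; if \<open>f\<close> is \<open>0\<close>, then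
  \<open>g\<close> is at most a multiple of \<open>|\<xi>|\<^sup>2\<close>. In both cases \<open>1/g\<close> dominates a multiple of a function
  with infinite integral.
\<close>

lemma recurrence_transfer:
  fixes f g :: "real^2 \<Rightarrow> ennreal"
  assumes [measurable]: "g \<in> borel_measurable borel"
    and A: "0 \<le> A" "\<And>\<xi>. g \<xi> \<le> f \<xi> + ennreal (A * (norm \<xi>)\<^sup>2)"
    and f: "(\<forall>\<xi>. f \<xi> = 0) \<or> (\<exists>C>0. \<forall>\<xi>\<in>ball 0 r. ennreal (C * (norm \<xi>)\<^sup>2) \<le> f \<xi>)"
    and r: "0 < r" and inf: "(\<integral>\<^sup>+\<xi>\<in>ball 0 r. 1 / f \<xi> \<partial>lborel) = \<infinity>"
  shows "(\<integral>\<^sup>+\<xi>\<in>ball 0 r. 1 / g \<xi> \<partial>lborel) = \<infinity>"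
proof -
  have "\<exists>k>0. \<exists>h. (\<integral>\<^sup>+\<xi>\<in>ball 0 r. 1 / h \<xi> \<partial>lborel) = \<infinity> \<and> (\<forall>\<xi>\<in>ball 0 r. g \<xi> \<le> ennreal k * h \<xi>)"
    using f
  proof
    assume "\<forall>\<xi>. f \<xi> = 0"
    \<comment> \<open>\<open>A + 1\<close> instead of \<open>A\<close>, since the factor has to be positive\<close>
    then have "g \<xi> \<le> ennreal (A + 1) * ennreal ((norm \<xi>)\<^sup>2)" for \<xi>
    proof -
      have "g \<xi> \<le> ennreal (A * (norm \<xi>)\<^sup>2)" using A(2)[of \<xi>] \<open>\<forall>\<xi>. f \<xi> = 0\<close> by simp
      also have "\<dots> \<le> ennreal ((A + 1) * (norm \<xi>)\<^sup>2)" by (intro ennreal_leI mult_right_mono) auto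
      finally show ?thesis using A(1) by (simp only: ennreal_mult[of "A + 1"] zero_le_power2 add_nonneg_nonneg zero_le_one)
    qed
    then show ?thesis using A(1) inverse_norm_power2_not_integrable[OF r]
      by (intro exI[of _ "A + 1"] conjI exI[of _ "\<lambda>\<xi>. ennreal ((norm \<xi>)\<^sup>2)"]) auto
  next
    assume "\<exists>C>0. \<forall>\<xi>\<in>ball 0 r. ennreal (C * (norm \<xi>)\<^sup>2) \<le> f \<xi>"
    then obtain C where C: "C > 0" "\<And>\<xi>. \<xi> \<in> ball 0 r \<Longrightarrow> ennreal (C * (norm \<xi>)\<^sup>2) \<le> f \<xi>" by blast
    have "g \<xi> \<le> ennreal (1 + A / C) * f \<xi>" if "\<xi> \<in> ball 0 r" for \<xi>
    proof -
      have "ennreal (A * (norm \<xi>)\<^sup>2) = ennreal (A / C) * ennreal (C * (norm \<xi>)\<^sup>2)"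
        using C(1) A(1) by (simp flip: ennreal_mult)
      also have "\<dots> \<le> ennreal (A / C) * f \<xi>" by (intro mult_left_mono C that) simp
      finally have "g \<xi> \<le> f \<xi> + ennreal (A / C) * f \<xi>"
        using A(2)[of \<xi>] by (meson add_left_mono order_trans)
      then show ?thesis using A(1) C(1) by (simp add: ennreal_plus distrib_right)
    qed
    then show ?thesis using A(1) C(1) inf
      by (intro exI[of _ "1 + A / C"] conjI exI[of _ f]) (auto intro: add_pos_nonneg)
  qed
  then obtain k h where "0 < k" and h: "(\<integral>\<^sup>+\<xi>\<in>ball 0 r. 1 / h \<xi> \<partial>lborel) = \<infinity>"
    and le: "\<And>\<xi>. \<xi> \<in> ball 0 r \<Longrightarrow> g \<xi> \<le> ennreal k * h \<xi>" by blast
  have "\<infinity> \<le> ennreal k * (\<integral>\<^sup>+\<xi>\<in>ball 0 r. 1 / g \<xi> \<partial>lborel)"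
    using nn_integral_inverse_le[OF assms(1) \<open>0 < k\<close>, of r h] le by (simp add: h)
  then show ?thesis by (auto simp: top_unique ennreal_mult_eq_top_iff)
qed

lemma transience_transfer:
  fixes f g :: "'a::euclidean_space \<Rightarrow> ennreal"
  assumes "f \<in> borel_measurable borel" "0 < k" "0 < s"
    and le: "\<And>\<xi>. \<xi> \<in> ball 0 s \<Longrightarrow> f \<xi> \<le> ennreal k * g \<xi>"
    and "\<exists>r>0. (\<integral>\<^sup>+\<xi>\<in>ball 0 r. 1 / f \<xi> \<partial>lborel) < \<infinity>"
  shows "\<exists>r>0. (\<integral>\<^sup>+\<xi>\<in>ball 0 r. 1 / g \<xi> \<partial>lborel) < \<infinity>"
proof -
  obtain r where r: "0 < r" "(\<integral>\<^sup>+\<xi>\<in>ball 0 r. 1 / f \<xi> \<partial>lborel) < \<infinity>" using assms by blast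
  have "(\<integral>\<^sup>+\<xi>\<in>ball 0 (min r s). 1 / g \<xi> \<partial>lborel) \<le>
      ennreal k * (\<integral>\<^sup>+\<xi>\<in>ball 0 (min r s). 1 / f \<xi> \<partial>lborel)"
    using assms(1,2) le by (intro nn_integral_inverse_le) auto
  also have "\<dots> \<le> ennreal k * (\<integral>\<^sup>+\<xi>\<in>ball 0 r. 1 / f \<xi> \<partial>lborel)"
    by (intro mult_left_mono nn_integral_mono) (auto simp: indicator_def)
  also have "\<dots> < \<infinity>" using r by (simp add: ennreal_mult_less_top)
  finally show ?thesis using r \<open>0 < s\<close> by (intro exI[of _ "min r s"]) auto
qed

text \<open>
  Upper envelopes of continuous functions are lower semicontinuous, which makes them measurable even
  for uncountable index sets; lower envelopes are dealt with dually.
\<close>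

lemma borel_measurable_SUP_continuous:
  fixes f :: "'i \<Rightarrow> 'a::topological_space \<Rightarrow> ennreal"
  assumes "\<And>i. continuous_on UNIV (f i)"
  shows "(\<lambda>x. SUP i. f i x) \<in> borel_measurable borel"
proof (rule borel_measurableI_greater)
  fix y
  have "{x \<in> space borel. y < (SUP i. f i x)} = (\<Union>i. {x. y < f i x})"
    by (auto simp: less_SUP_iff)
  moreover have "open (\<Union>i. {x. y < f i x})"
    by (intro open_UN ballI open_Collect_less assms continuous_on_const)
  ultimately show "{x \<in> space borel. y < (SUP i. f i x)} \<in> sets borel" by auto
qed

lemma borel_measurable_INF_continuous:
  fixes f :: "'i \<Rightarrow> 'a::topological_space \<Rightarrow> ennreal"
  assumes "\<And>i. continuous_on UNIV (f i)"
  shows "(\<lambda>x. INF i. f i x) \<in> borel_measurable borel"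
proof (rule borel_measurableI_less)
  fix y
  have "{x \<in> space borel. (INF i. f i x) < y} = (\<Union>i. {x. f i x < y})"
    by (auto simp: INF_less_iff)
  moreover have "open (\<Union>i. {x. f i x < y})"
    by (intro open_UN ballI open_Collect_less assms continuous_on_const)
  ultimately show "{x \<in> space borel. (INF i. f i x) < y} \<in> sets borel" by auto
qed

lemma INF_le_ennreal_mult_INF:
  fixes f :: "'i \<Rightarrow> ennreal" and g :: "'j \<Rightarrow> ennreal"
  assumes k: "0 < k" and le: "\<And>j. \<exists>i. f i \<le> ennreal k * g j"
  shows "(INF i. f i) \<le> ennreal k * (INF j. g j)"
proof -
  have inv: "ennreal (1 / k) * (ennreal k * z) = z" "ennreal k * (ennreal (1 / k) * z) = z" for z
    using k by (simp_all add: mult.assoc[symmetric] flip: ennreal_mult)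
  have "ennreal (1 / k) * (INF i. f i) \<le> g j" for j
  proof -
    obtain i where "f i \<le> ennreal k * g j" using le by blast
    then have "(INF i. f i) \<le> ennreal k * g j" by (rule order_trans[OF INF_lower[OF UNIV_I]])
    then have "ennreal (1 / k) * (INF i. f i) \<le> ennreal (1 / k) * (ennreal k * g j)"
      by (rule mult_left_mono) simp
    then show ?thesis by (simp only: inv)
  qed
  then have "ennreal (1 / k) * (INF i. f i) \<le> (INF j. g j)" by (intro INF_greatest)
  then have "ennreal k * (ennreal (1 / k) * (INF i. f i)) \<le> ennreal k * (INF j. g j)"
    by (rule mult_left_mono) simp
  then show ?thesis by (simp only: inv)
qed

section \<open>Invariance of the recurrence and transience criteria\<close>

theorem theorem3p2:
  fixes P :: "real^2 \<Rightarrow> 'w measure" and F :: "real \<Rightarrow> 'w \<Rightarrow> real^2"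
    and P' :: "real^2 \<Rightarrow> 'v measure" and F' :: "real \<Rightarrow> 'v \<Rightarrow> real^2"
    and q q' :: "real^2 \<Rightarrow> real^2 \<Rightarrow> complex"
    and c c' :: "real^2 \<Rightarrow> real"
    and \<nu> \<nu>' :: "real^2 \<Rightarrow> (real^2) measure"
    and \<phi> :: real
  assumes "levy_type_process P F q" and "levy_type_process P' F' q'"
    and "open_set_irreducible P F" and "open_set_irreducible P' F'"
    and "radial_in_covariable q" and "radial_in_covariable q'"
    and "c \<in> borel_measurable borel" and "\<And>x. 0 \<le> c x"
    and "c' \<in> borel_measurable borel" and "\<And>x. 0 \<le> c' x"
    and "levy_triplet q (\<lambda>x. 0) (\<lambda>x. c x *\<^sub>R mat 1) \<nu>"
    and "levy_triplet q' (\<lambda>x. 0) (\<lambda>x. c' x *\<^sub>R mat 1) \<nu>'"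
    and "0 \<le> \<phi>" and "\<phi> < 2 * pi"
    and P: "(SUP x. \<integral>\<^sup>+y. ennreal ((norm y)\<^sup>2)
               \<partial>(total_variation_diff (\<nu> x) (\<nu>' (plane_rotation \<phi> *v x)))) < \<infinity>"
  shows "((\<exists>r>0. (\<integral>\<^sup>+\<xi>\<in>ball 0 r. 1 / (SUP x. ennreal (cmod (q x \<xi>))) \<partial>lborel) = \<infinity>) \<longleftrightarrow>
          (\<exists>r>0. (\<integral>\<^sup>+\<xi>\<in>ball 0 r. 1 / (SUP x. ennreal (cmod (q' x \<xi>))) \<partial>lborel) = \<infinity>)) \<and>
         (enn2ereal
            (1 / 2 * (SUP x. ennreal \<bar>c x - c' (plane_rotation \<phi> *v x)\<bar>) +
             (SUP x. \<integral>\<^sup>+y. ennreal ((norm y)\<^sup>2)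
                \<partial>(total_variation_diff (\<nu> x) (\<nu>' (plane_rotation \<phi> *v x)))))
          < Liminf (at 0) (\<lambda>\<xi>. (INF x. ereal (Re (q x \<xi>))) / ereal ((norm \<xi>)\<^sup>2)) \<longrightarrow>
          ((\<exists>r>0. (\<integral>\<^sup>+\<xi>\<in>ball 0 r. 1 / (INF x. ennreal (Re (q x \<xi>))) \<partial>lborel) < \<infinity>) \<longleftrightarrow>
           (\<exists>r>0. (\<integral>\<^sup>+\<xi>\<in>ball 0 r. 1 / (INF x. ennreal (Re (q' x \<xi>))) \<partial>lborel) < \<infinity>)))"
proof -
  note levy = assms(1,2) and radial = assms(5,6) and c = assms(8,10) and triplet = assms(11,12)
  define R where "R x = plane_rotation \<phi> *v x" for x
  define Q where "Q x = levy_exponent (c x) (\<nu> x)" for x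
  define Q' where "Q' x = levy_exponent (c' x) (\<nu>' x)" for x
  have q: "q x \<xi> = complex_of_real (Q x \<xi>)" and q': "q' x \<xi> = complex_of_real (Q' x \<xi>)" for x \<xi>
    unfolding Q_def Q'_def
    by (rule radial_symbol_eq_levy_exponent[OF radial(1) triplet(1)],
        rule radial_symbol_eq_levy_exponent[OF radial(2) triplet(2)])
  have Q_nonneg: "0 \<le> Q x \<xi>" and Q'_nonneg: "0 \<le> Q' x \<xi>" for x \<xi>
    by (simp_all add: Q_def Q'_def levy_exponent_nonneg c)
  have cont: "continuous_on UNIV (q x)" "continuous_on UNIV (q' x)" for x
    using levy by (simp_all add: levy_type_process_def is_symbol_def)
  have R_surj: "\<exists>x. x' = R x" for x' unfolding R_def using plane_rotation_surj by metis

  let ?SM = "SUP x. \<integral>\<^sup>+y. ennreal ((norm y)\<^sup>2) \<partial>(total_variation_diff (\<nu> x) (\<nu>' (R x)))"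
  let ?SD = "SUP x. ennreal \<bar>c x - c' (R x)\<bar>"
  obtain M where M: "0 \<le> M" "?SM = ennreal M"
    using P unfolding R_def by (cases "SUP x. \<integral>\<^sup>+y. ennreal ((norm y)\<^sup>2)
      \<partial>(total_variation_diff (\<nu> x) (\<nu>' (plane_rotation \<phi> *v x)))") auto
  obtain B B' where B: "\<And>x. c x \<le> B" "\<And>x. c' x \<le> B'"
    using levy_type_diffusion_bounded[OF levy(1) radial(1) triplet(1)]
      levy_type_diffusion_bounded[OF levy(2) radial(2) triplet(2)] by metis
  have "?SD \<le> ennreal (B + B')"
  proof (rule SUP_least)
    fix x
    show "ennreal \<bar>c x - c' (R x)\<bar> \<le> ennreal (B + B')"
      using B(1)[of x] B(2)[of "R x"] c(1)[of x] c(2)[of "R x"] by (intro ennreal_leI) simp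
  qed
  then obtain D where D: "0 \<le> D" "?SD = ennreal D" by (cases ?SD) (auto simp: top_unique)
  define A where "A = D / 2 + M"
  have A: "0 \<le> A" using D M by (simp add: A_def)
  have close: "\<bar>Q x \<xi> - Q' (R x) \<xi>\<bar> \<le> A * (norm \<xi>)\<^sup>2" for x \<xi>
    unfolding Q_def Q'_def A_def
  proof (rule levy_exponent_diff_le[OF _ _ M(1)])
    show "levy_measure (\<nu> x)" "levy_measure (\<nu>' (R x))" using triplet by (simp_all add: levy_triplet_def)
    show "(\<integral>\<^sup>+y. ennreal ((norm y)\<^sup>2) \<partial>(total_variation_diff (\<nu> x) (\<nu>' (R x)))) \<le> ennreal M"
      unfolding M(2)[symmetric] by (rule SUP_upper) simp
    have "ennreal \<bar>c x - c' (R x)\<bar> \<le> ennreal D" unfolding D(2)[symmetric] by (rule SUP_upper) simp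
    then show "\<bar>c x - c' (R x)\<bar> \<le> D" using D(1) by simp
  qed

  let ?S = "\<lambda>\<xi>. SUP x. ennreal (cmod (q x \<xi>))" and ?S' = "\<lambda>\<xi>. SUP x. ennreal (cmod (q' x \<xi>))"
  have meas_S: "?S \<in> borel_measurable borel" "?S' \<in> borel_measurable borel"
    using cont by (intro borel_measurable_SUP_continuous continuous_on_ennreal continuous_intros; simp)+
  have S'_le: "?S' \<xi> \<le> ?S \<xi> + ennreal (A * (norm \<xi>)\<^sup>2)" for \<xi>
  proof (rule SUP_least)
    fix x'
    obtain x where x: "x' = R x" using R_surj by blast
    have "ennreal (cmod (q' x' \<xi>)) \<le> ennreal (cmod (q x \<xi>) + A * (norm \<xi>)\<^sup>2)"
      using close[of x \<xi>] Q_nonneg[of x \<xi>] Q'_nonneg[of x' \<xi>] by (intro ennreal_leI) (simp add: q q' x)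
    also have "\<dots> = ennreal (cmod (q x \<xi>)) + ennreal (A * (norm \<xi>)\<^sup>2)"
      using A by (intro ennreal_plus) auto
    also have "\<dots> \<le> ?S \<xi> + ennreal (A * (norm \<xi>)\<^sup>2)" by (intro add_right_mono SUP_upper) simp
    finally show "ennreal (cmod (q' x' \<xi>)) \<le> ?S \<xi> + ennreal (A * (norm \<xi>)\<^sup>2)" .
  qed
  have S_le: "?S \<xi> \<le> ?S' \<xi> + ennreal (A * (norm \<xi>)\<^sup>2)" for \<xi>
  proof (rule SUP_least)
    fix x
    have "ennreal (cmod (q x \<xi>)) \<le> ennreal (cmod (q' (R x) \<xi>) + A * (norm \<xi>)\<^sup>2)"
      using close[of x \<xi>] Q_nonneg[of x \<xi>] Q'_nonneg[of "R x" \<xi>] by (intro ennreal_leI) (simp add: q q')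
    also have "\<dots> = ennreal (cmod (q' (R x) \<xi>)) + ennreal (A * (norm \<xi>)\<^sup>2)"
      using A by (intro ennreal_plus) auto
    also have "\<dots> \<le> ?S' \<xi> + ennreal (A * (norm \<xi>)\<^sup>2)" by (intro add_right_mono SUP_upper) simp
    finally show "ennreal (cmod (q x \<xi>)) \<le> ?S' \<xi> + ennreal (A * (norm \<xi>)\<^sup>2)" .
  qed
  have recurrence: "(\<exists>r>0. (\<integral>\<^sup>+\<xi>\<in>ball 0 r. 1 / ?S \<xi> \<partial>lborel) = \<infinity>) \<longleftrightarrow>
      (\<exists>r>0. (\<integral>\<^sup>+\<xi>\<in>ball 0 r. 1 / ?S' \<xi> \<partial>lborel) = \<infinity>)"
  proof (intro iffI; elim exE conjE)
    fix r :: real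
    assume r: "0 < r"
    {
      assume "(\<integral>\<^sup>+\<xi>\<in>ball 0 r. 1 / ?S \<xi> \<partial>lborel) = \<infinity>"
      with r show "\<exists>r>0. (\<integral>\<^sup>+\<xi>\<in>ball 0 r. 1 / ?S' \<xi> \<partial>lborel) = \<infinity>"
        by (intro exI[of _ r] conjI recurrence_transfer[OF meas_S(2) A S'_le]
              symbol_sup_degenerate_or_quadratic[OF radial(1) c(1) triplet(1)])
    next
      assume "(\<integral>\<^sup>+\<xi>\<in>ball 0 r. 1 / ?S' \<xi> \<partial>lborel) = \<infinity>"
      with r show "\<exists>r>0. (\<integral>\<^sup>+\<xi>\<in>ball 0 r. 1 / ?S \<xi> \<partial>lborel) = \<infinity>"
        by (intro exI[of _ r] conjI recurrence_transfer[OF meas_S(1) A S_le]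
              symbol_sup_degenerate_or_quadratic[OF radial(2) c(2) triplet(2)])
    }
  qed

  let ?I = "\<lambda>\<xi>. INF x. ennreal (Re (q x \<xi>))" and ?I' = "\<lambda>\<xi>. INF x. ennreal (Re (q' x \<xi>))"
  have transience: "(\<exists>r>0. (\<integral>\<^sup>+\<xi>\<in>ball 0 r. 1 / ?I \<xi> \<partial>lborel) < \<infinity>) \<longleftrightarrow>
      (\<exists>r>0. (\<integral>\<^sup>+\<xi>\<in>ball 0 r. 1 / ?I' \<xi> \<partial>lborel) < \<infinity>)"
    if liminf: "enn2ereal (1 / 2 * ?SD + ?SM) <
      Liminf (at 0) (\<lambda>\<xi>. (INF x. ereal (Re (q x \<xi>))) / ereal ((norm \<xi>)\<^sup>2))"
  proof -
    have half: "(1 / 2 :: ennreal) = ennreal (1 / 2)" by (simp add: divide_ennreal_def)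
    have "1 / 2 * ?SD + ?SM = ennreal (1 / 2 * D) + ennreal M"
      unfolding D(2) M(2) half using D(1) by (subst ennreal_mult) (simp_all only: zero_le_divide_1_iff zero_le_numeral)
    also have "\<dots> = ennreal A" using D(1) M(1) by (simp add: A_def)
    finally have "ereal A < Liminf (at 0) (\<lambda>\<xi>. (INF x. ereal (Re (q x \<xi>))) / ereal ((norm \<xi>)\<^sup>2))"
      using liminf A by simp
    from ereal_dense2[OF this] obtain A' where A': "A < A'"
      "ereal A' < Liminf (at 0) (\<lambda>\<xi>. (INF x. ereal (Re (q x \<xi>))) / ereal ((norm \<xi>)\<^sup>2))"
      by (auto simp only: less_ereal.simps)
    from less_LiminfD[OF A'(2)] obtain s where s: "s > 0"
      "\<And>\<xi>. \<xi> \<noteq> 0 \<Longrightarrow> norm \<xi> < s \<Longrightarrow> ereal A' < (INF x. ereal (Re (q x \<xi>))) / ereal ((norm \<xi>)\<^sup>2)"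
      by (auto simp: eventually_at)
    have lower: "A' * (norm \<xi>)\<^sup>2 \<le> Q x \<xi>" if "\<xi> \<in> ball 0 s" for x \<xi>
    proof (cases "\<xi> = 0")
      case False
      then have "ereal A' < (INF x. ereal (Re (q x \<xi>))) / ereal ((norm \<xi>)\<^sup>2)" using s(2) that by simp
      also have "\<dots> \<le> ereal (Re (q x \<xi>)) / ereal ((norm \<xi>)\<^sup>2)"
        using False by (intro ereal_divide_right_mono INF_lower) auto
      finally show ?thesis using False by (simp add: q field_simps)
    qed (simp add: Q_nonneg)
    \<comment> \<open>\<open>Q' \<ge> Q - A|\<xi>|\<^sup>2 \<ge> (1 - A/A') Q\<close>, whence the factor\<close>
    define k where "k = A' / (A' - A)"
    have k: "k > 0" using A A'(1) by (simp add: k_def)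
    have pt: "Q x \<xi> \<le> k * Q' (R x) \<xi>" "Q' (R x) \<xi> \<le> 2 * Q x \<xi>" if \<xi>: "\<xi> \<in> ball 0 s" for x \<xi>
    proof -
      have "A * (norm \<xi>)\<^sup>2 \<le> A' * (norm \<xi>)\<^sup>2" using A'(1) by (intro mult_right_mono) auto
      then show "Q' (R x) \<xi> \<le> 2 * Q x \<xi>" using close[of x \<xi>] lower[OF \<xi>, of x] by linarith
      have "A' * (Q x \<xi> - Q' (R x) \<xi>) \<le> A' * (A * (norm \<xi>)\<^sup>2)"
        using close[of x \<xi>] A A'(1) by (intro mult_left_mono) auto
      also have "\<dots> = A * (A' * (norm \<xi>)\<^sup>2)" by simp
      also have "\<dots> \<le> A * Q x \<xi>" using lower[OF \<xi>, of x] A by (intro mult_left_mono) auto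
      finally show "Q x \<xi> \<le> k * Q' (R x) \<xi>"
        using A'(1) by (simp add: k_def field_simps)
    qed
    have meas_I: "?I \<in> borel_measurable borel" "?I' \<in> borel_measurable borel"
      using cont by (intro borel_measurable_INF_continuous continuous_on_ennreal continuous_intros; simp)+
    have I_le: "?I \<xi> \<le> ennreal k * ?I' \<xi>" if "\<xi> \<in> ball 0 s" for \<xi>
    proof (rule INF_le_ennreal_mult_INF[OF k])
      fix x'
      obtain x where "x' = R x" using R_surj by blast
      then show "\<exists>x. ennreal (Re (q x \<xi>)) \<le> ennreal k * ennreal (Re (q' x' \<xi>))"
        using pt(1)[OF that, of x] k Q'_nonneg
        by (intro exI[of _ x]) (simp add: q q' flip: ennreal_mult)
    qed
    have I'_le: "?I' \<xi> \<le> ennreal 2 * ?I \<xi>" if "\<xi> \<in> ball 0 s" for \<xi>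
    proof (rule INF_le_ennreal_mult_INF)
      fix x
      have "ennreal (Q' (R x) \<xi>) \<le> ennreal (2 * Q x \<xi>)" by (intro ennreal_leI pt(2) that)
      also have "\<dots> = ennreal 2 * ennreal (Q x \<xi>)" using Q_nonneg by (intro ennreal_mult) auto
      finally show "\<exists>x'. ennreal (Re (q' x' \<xi>)) \<le> ennreal 2 * ennreal (Re (q x \<xi>))"
        by (intro exI[of _ "R x"]) (simp only: q q' Re_complex_of_real)
    qed simp
    show ?thesis
      by (rule iffI; rule transience_transfer[OF meas_I(1) k s(1) I_le]
            transience_transfer[OF meas_I(2) zero_less_numeral s(1) I'_le])
  qed
  show ?thesis using recurrence transience unfolding R_def by blast
qed

end
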